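(* Let $\ell$ be a fixed positive integer. Then there exist constants $C_\ell>0$ and $T_0(\ell)$, depending only on $\ell$, such that for all $T\ge T_0(\ell)$, $$ \max_{t \in [\sqrt{T},T]}\prod_{j=1}^\ell |\zeta(1+ijt)| \ge e^{\ell \gamma} \Big\{(\log_2 T)^\ell + \ell (\log_2 T)^{\ell -1}\log_3 T - C_\ell\,(\log_2 T)^{\ell -1} \Big\}. $$ Equivalently, $\max_{t \in [\sqrt{T},T]}\prod_{j=1}^\ell |\zeta(1+ijt)| \ge e^{\ell \gamma} \{(\log_2 T)^\ell + \ell (\log_2 T)^{\ell -1}\log_3 T + O_\ell((\log_2 T)^{\ell -1}) \}$ for sufficiently large $T$, where the implied constant depends only on $\ell$.
   Context: $\zeta$ denotes the Riemann zeta function, $\gamma$ is the Euler–Mascheroni constant, and $\log_k$ denotes the $k$-fold iterated logarithm (so $\log_2 T=\log\log T$, $\log_3 T=\log\log\log T$). *)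

theory Defs
  imports "HOL-Analysis.Analysis"
begin

text \<open>Riemann zeta function on the half-plane Re s > 0, s \<noteq> 1, via its
  standard analytic continuation
  zeta s = lim_{N \<rightarrow> \<infinity>} (\<Sum>_{n=1}^N n^{-s} - N^{1-s}/(1-s)).
  For Re s > 1 this agrees with the Dirichlet series; for 0 < Re s, s \<noteq> 1 the
  limit exists and equals the analytic continuation.\<close>
definition zeta :: "complex \<Rightarrow> complex" where
  "zeta s = lim (\<lambda>N::nat. (\<Sum>n=1..N. 1 / (of_nat n) powr s)
                             - (of_nat N) powr (1 - s) / (1 - s))"

end

(*
  Truncating the series for zeta (1 + ijt) at a huge N turns the product over j into a Dirichlet
  polynomial D(t) with nonnegative coefficients, uniformly for sqrt T <= t <= T.  It is compared with
  the resonator R(t) = PROD p<=x. 1 / (1 - q_p p^(it)), q_p = 1 - p/x, x ~ c log T loglog T, so that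
  R(0)^2 is at most T^(1/8).  Because p^(-it) R(t) - q_p R(t) is again a trigonometric series with
  nonnegative coefficients, D |R|^2 dominates Z |R|^2, where Z is the product over j <= l and p <= x
  of the truncated Euler factors of q_p^j / p.  Averaging over the differences t = sqrt T (a - b),
  0 <= a, b < m = floor (sqrt T), preserves this domination (the Fejer kernel is positive), and only
  the diagonal a = b lies outside sqrt T <= |t| <= T; it costs m D(0) R(0)^2 against a total mass of
  at least m^2.  So some t has |D(t)| >= Z - o(1), and Mertens' third theorem gives
  Z >= (e^gamma (log x - O(1)))^l.

  The constant in Mertens' theorem is found by comparing the sum of - log (1 - 1/p) over p <= n with
  the harmonic number H(floor (log n)): weighted by n^(-delta), the former gives at least
  log zeta (1 + delta) and the latter at most - log (1 - e^(-delta)), and the difference of these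
  tends to 0 as delta tends to 0.
*)

theory Submission
  imports Defs "HOL-Computational_Algebra.Computational_Algebra" "HOL-Real_Asymp.Real_Asymp"
begin

subsection \<open>Chebyshev and Mertens estimates\<close>

text \<open>The choice q_p = 1 - p/x balances two losses. The size R(0) is the product of x/p, and
  by Chebyshev's bound the sum of ln (x/p) over p <= x is only O(x / ln x). Hence x can be a
  constant times ln T ln ln T, and ln x = ln ln T + ln ln ln T + O(1); this is the origin of the
  second-order term. On the other side, q_p^j / p in place of 1/p costs each Euler factor a relative
  1 - O(j/x), which over O(x / ln x) primes amounts to 1 - O(l / ln x), absorbed by the O(1) next to
  ln x. The truncation point can be as large as N = x^(x^2), because D(0) is at most a power of ln N
  and so of ln T, against a factor 1/m of order T^(-1/2). The restriction t >= sqrt T keeps the pole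
  term N^(1-s)/(1-s) small: on Re s = 1 its modulus is 1/|Im s| for every N. In Mertens' theorem the
  growth of the sum follows from elementary prime estimates, but the constant gamma does not; it
  needs a comparison near the pole of zeta.\<close>

definition primes_upto :: "nat \<Rightarrow> nat set" where
  "primes_upto n = {p. prime p \<and> p \<le> n}"

lemma finite_primes_upto [simp, intro]: "finite (primes_upto n)"
  unfolding primes_upto_def by auto

lemma primes_upto_Suc:
  "primes_upto (Suc n) = (if prime (Suc n) then insert (Suc n) (primes_upto n) else primes_upto n)"
  by (auto simp: primes_upto_def le_Suc_eq)

lemma Suc_notin_primes_upto [simp]: "Suc n \<notin> primes_upto n"
  by (auto simp: primes_upto_def)

lemma primes_upto_0 [simp]: "primes_upto 0 = {}" "primes_upto (Suc 0) = {}"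
  by (auto simp: primes_upto_def dest: prime_gt_1_nat)

lemma primes_uptoD: "p \<in> primes_upto n \<Longrightarrow> prime p" "p \<in> primes_upto n \<Longrightarrow> p \<le> n"
  "p \<in> primes_upto n \<Longrightarrow> 2 \<le> p"
  by (auto simp: primes_upto_def dest: prime_ge_2_nat)

lemma sum_primes_upto_Suc:
  "sum f (primes_upto (Suc n)) = sum f (primes_upto n) + (if prime (Suc n) then f (Suc n) else 0)"
  by (simp add: primes_upto_Suc add.commute)

section \<open>Chebyshev's upper bound for the product of the primes up to n\<close>

lemma choose_odd_le: "(2*m+1) choose m \<le> 4 ^ m"
proof -
  have "(2*m+1) choose m = (2*m+1) choose (m+1)"
    by (subst binomial_symmetric) auto
  moreover have "((2*m+1) choose m) + ((2*m+1) choose (m+1)) = (\<Sum>k\<in>{m,m+1}. (2*m+1) choose k)"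
    by simp
  moreover have "\<dots> \<le> (\<Sum>k\<le>2*m+1. (2*m+1) choose k)"
    by (rule sum_mono2) auto
  moreover have "\<dots> = 2 * 4 ^ m"
    by (simp only: choose_row_sum) (simp add: power_mult)
  ultimately show ?thesis by linarith
qed

text \<open>Such a prime divides (2m+1)! but neither m! nor (m+1)!, so it must divide the binomial
  quotient.\<close>

lemma prime_dvd_choose_odd:
  assumes "prime p" "m + 1 < p" "p \<le> 2 * m + 1"
  shows "p dvd (2*m+1) choose m"
proof -
  have "p dvd fact (2*m+1)" using assms by (simp add: prime_dvd_fact_iff del: fact_Suc)
  also have "fact (2*m+1) = fact m * fact (m+1) * ((2*m+1) choose m)"
    using binomial_fact_lemma[of m "2*m+1"] by simp
  finally show ?thesis
    using assms by (simp add: prime_dvd_mult_iff prime_dvd_fact_iff del: fact_Suc)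
qed

lemma prod_dvd_coprime:
  fixes f :: "'b \<Rightarrow> nat"
  assumes "finite A" "\<And>a. a \<in> A \<Longrightarrow> f a dvd n"
    "\<And>a b. a \<in> A \<Longrightarrow> b \<in> A \<Longrightarrow> a \<noteq> b \<Longrightarrow> coprime (f a) (f b)"
  shows "prod f A dvd n"
  using assms
proof (induction A rule: finite_induct)
  case (insert a A)
  then have "coprime (f a) (prod f A)" by (intro prod_coprime_right) auto
  with insert show ?case by (auto intro!: divides_mult)
qed auto

text \<open>Erdos' induction. An even n > 2 adds no prime. For n = 2m+1 the primes up to m+1 are
  covered by the induction hypothesis, and the primes above m+1 together divide a central binomial
  coefficient, which is at most 4^m.\<close>

lemma prod_primes_upto_le: "\<Prod>(primes_upto n) \<le> 4 ^ n"
proof (induction n rule: less_induct)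
  case (less n)
  consider "n \<le> 2" | "n > 2" "even n" | "n > 2" "odd n" by linarith
  then show ?case
  proof cases
    case 1
    then consider "n = 0" | "n = 1" | "n = 2" by linarith
    then show ?thesis by cases (auto simp: primes_upto_Suc numeral_2_eq_2)
  next
    case 2
    then have "\<not> prime n" using prime_odd_nat by blast
    moreover obtain k where k: "n = Suc k" using 2 by (cases n) auto
    ultimately have "primes_upto n = primes_upto k" by (simp add: primes_upto_Suc)
    then have "\<Prod>(primes_upto n) \<le> 4 ^ k" using less[of k] k by simp
    also have "\<dots> \<le> 4 ^ n" using k by (simp add: power_increasing)
    finally show ?thesis .
  next
    case 3
    then obtain m where m: "n = 2*m+1" by (auto elim: oddE)
    then have m0: "m > 0" using 3 by simp
    have un: "primes_upto n = primes_upto (m+1) \<union> {p. prime p \<and> m + 1 < p \<and> p \<le> n}"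
      using m by (auto simp: primes_upto_def)
    have "\<Prod>(primes_upto n) = \<Prod>(primes_upto (m+1)) * \<Prod>{p. prime p \<and> m + 1 < p \<and> p \<le> n}"
      unfolding un by (rule prod.union_disjoint) (auto simp: primes_upto_def)
    also have "\<dots> \<le> 4 ^ (m+1) * 4 ^ m"
    proof (rule mult_mono)
      show "\<Prod>(primes_upto (m+1)) \<le> 4 ^ (m+1)" using less[of "m+1"] m m0 by simp
      have "\<Prod>{p. prime p \<and> m + 1 < p \<and> p \<le> n} dvd (2*m+1) choose m"
        by (rule prod_dvd_coprime) (auto simp: m intro: primes_coprime prime_dvd_choose_odd[unfolded Suc_eq_plus1[symmetric]])
      then have "\<Prod>{p. prime p \<and> m + 1 < p \<and> p \<le> n} \<le> (2*m+1) choose m"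
        by (rule dvd_imp_le) simp
      then show "\<Prod>{p. prime p \<and> m + 1 < p \<and> p \<le> n} \<le> 4 ^ m"
        using choose_odd_le[of m] by linarith
    qed auto
    also have "\<dots> = 4 ^ n" using m by (simp add: power_add[symmetric] mult_2)
    finally show ?thesis .
  qed
qed

lemma sum_ln_primes_upto_le: "(\<Sum>p\<in>primes_upto n. ln (real p)) \<le> ln 4 * real n"
proof -
  have "(\<Sum>p\<in>primes_upto n. ln (real p)) = ln (\<Prod>p\<in>primes_upto n. real p)"
    by (rule ln_prod[symmetric]) (auto dest: primes_uptoD)
  also have "\<dots> = ln (real (\<Prod>(primes_upto n)))" by simp
  also have "\<dots> \<le> ln (real (4 ^ n))"
  proof -
    have "0 < \<Prod>(primes_upto n)"
      by (rule prod_pos) (auto dest: primes_uptoD)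
    moreover have "real (\<Prod>(primes_upto n)) \<le> real (4 ^ n)"
      using prod_primes_upto_le by (simp only: of_nat_le_iff)
    ultimately show ?thesis by (subst ln_le_cancel_iff) (auto simp del: of_nat_prod)
  qed
  also have "\<dots> = ln 4 * real n" by (simp add: ln_realpow)
  finally show ?thesis .
qed

section \<open>Legendre's formula and Mertens' first theorem\<close>

lemma multiplicity_fact:
  assumes "prime (p::nat)"
  shows "multiplicity p (fact n :: nat) = (\<Sum>k=1..n. n div p ^ k)"
proof -
  have cnt: "multiplicity p m = (\<Sum>k=1..n. if p ^ k dvd m then 1 else 0)"
    if m: "m \<in> {1..n}" for m
  proof -
    have iff: "p ^ k dvd m \<longleftrightarrow> k \<le> multiplicity p m" for k
      using m prime_gt_1_nat[OF assms] by (intro power_dvd_iff_le_multiplicity) auto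
    \<comment> \<open>This makes the cut-off k <= n harmless: an exponent is smaller than the prime
      power it produces, and that power is at most m.\<close>
    have le: "multiplicity p m \<le> n"
    proof -
      have "p ^ multiplicity p m \<le> m" using m by (intro dvd_imp_le multiplicity_dvd) auto
      moreover have "multiplicity p m < p ^ multiplicity p m"
        using prime_gt_1_nat[OF assms] by (intro power_gt_expt) auto
      ultimately show ?thesis using m by auto
    qed
    have eq: "{1..n} \<inter> {k. p ^ k dvd m} = {1..multiplicity p m}"
      unfolding iff using le by auto
    have "(\<Sum>k=1..n. if p ^ k dvd m then 1 else 0 :: nat) = card ({1..n} \<inter> {k. p ^ k dvd m})"
      by (subst sum.If_cases) auto
    then show ?thesis unfolding eq by (metis card_atLeastAtMost diff_Suc_1)
  qed
  have "multiplicity p (fact n :: nat) = (\<Sum>m=1..n. multiplicity p m)"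
    unfolding fact_prod of_nat_id using assms
    by (subst prime_elem_multiplicity_prod_distrib) auto
  also have "\<dots> = (\<Sum>m=1..n. \<Sum>k=1..n. if p ^ k dvd m then 1 else 0)"
    using cnt by (rule sum.cong[OF refl])
  \<comment> \<open>Double counting of the pairs (m, k) with p^k dividing m.\<close>
  also have "\<dots> = (\<Sum>k=1..n. \<Sum>m=1..n. if p ^ k dvd m then 1 else 0)"
    by (rule sum.swap)
  also have "\<dots> = (\<Sum>k=1..n. n div p ^ k)"
  proof (rule sum.cong[OF refl])
    fix k assume "k \<in> {1..n}"
    have pos: "p ^ k > 0" using assms by (auto dest: prime_gt_0_nat)
    have "bij_betw (\<lambda>i. p ^ k * i) {1..n div p ^ k} ({1..n} \<inter> {m. p ^ k dvd m})"
    proof (rule bij_betwI[where g = "\<lambda>m. m div p ^ k"])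
      show "(\<lambda>i. p ^ k * i) \<in> {1..n div p ^ k} \<rightarrow> {1..n} \<inter> {m. p ^ k dvd m}"
        using pos by (auto simp: less_eq_div_iff_mult_less_eq mult.commute)
    next
      show "(\<lambda>m. m div p ^ k) \<in> {1..n} \<inter> {m. p ^ k dvd m} \<rightarrow> {1..n div p ^ k}"
        using pos by (auto simp: div_le_mono div_greater_zero_iff Suc_le_eq intro: dvd_imp_le)
    qed (use pos in auto)
    then have eq: "card ({1..n} \<inter> {m. p ^ k dvd m}) = n div p ^ k"
      using bij_betw_same_card by fastforce
    show "(\<Sum>m=1..n. if p ^ k dvd m then 1 else 0) = n div p ^ k"
      by (subst sum.If_cases) (use eq in simp_all)
  qed
  finally show ?thesis .
qed

lemma ln_fact_eq_sum_primes:
  "ln (fact n :: real) = (\<Sum>p\<in>primes_upto n. real (multiplicity p (fact n :: nat)) * ln (real p))"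
proof -
  have "(fact n :: nat) = (\<Prod>p\<in>prime_factors (fact n). p ^ multiplicity p (fact n))"
    by (subst prime_factorization_nat[symmetric]) auto
  also have "prime_factors (fact n :: nat) = primes_upto n"
    by (auto simp: prime_factors_dvd primes_upto_def prime_dvd_fact_iff)
  finally have "(fact n :: real) = real (\<Prod>p\<in>primes_upto n. p ^ multiplicity p (fact n))"
    by (metis of_nat_fact)
  then have "ln (fact n :: real) = ln (\<Prod>p\<in>primes_upto n. real p ^ multiplicity p (fact n :: nat))"
    by simp
  also have "\<dots> = (\<Sum>p\<in>primes_upto n. ln (real p ^ multiplicity p (fact n :: nat)))"
    by (rule ln_prod) (auto dest: primes_uptoD)
  also have "\<dots> = (\<Sum>p\<in>primes_upto n. real (multiplicity p (fact n :: nat)) * ln (real p))"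
    by (rule sum.cong) (auto simp: ln_realpow dest: primes_uptoD)
  finally show ?thesis .
qed

lemma multiplicity_fact_le:
  assumes "prime (p::nat)"
  shows "real (multiplicity p (fact n :: nat)) \<le> real n / (real p - 1)"
proof -
  have p: "real p > 1" using assms prime_gt_1_nat by force
  have "real (multiplicity p (fact n :: nat)) = (\<Sum>k=1..n. real (n div p ^ k))"
    using assms by (simp add: multiplicity_fact)
  also have "\<dots> \<le> (\<Sum>k=1..n. real n * (1 / real p) ^ k)"
  proof (rule sum_mono)
    fix k
    show "real (n div p ^ k) \<le> real n * (1 / real p) ^ k"
      using of_nat_div_le_of_nat[of n "p ^ k", where 'a = real] by (simp add: power_one_over)
  qed
  also have "\<dots> = real n * ((1 / real p) * (\<Sum>k<n. (1 / real p) ^ k))"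
    by (simp add: sum_divide_distrib sum_distrib_left[symmetric] sum.atLeast1_atMost_eq)
  also have "\<dots> \<le> real n * (1 / (real p - 1))"
  proof (rule mult_left_mono)
    have "(\<Sum>k<n. (1 / real p) ^ k) \<le> (\<Sum>k. (1 / real p) ^ k)"
      using p by (intro sum_le_suminf summable_geometric) auto
    also have "\<dots> = 1 / (1 - 1 / real p)" using p by (intro suminf_geometric) auto
    finally have "(1 / real p) * (\<Sum>k<n. (1 / real p) ^ k) \<le> (1 / real p) * (1 / (1 - 1 / real p))"
      using p by (intro mult_left_mono) auto
    also have "\<dots> = 1 / (real p - 1)" using p by (simp add: field_simps)
    finally show "(1 / real p) * (\<Sum>k<n. (1 / real p) ^ k) \<le> 1 / (real p - 1)" .
  qed auto
  finally show ?thesis by simp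
qed

text \<open>The quotient n^n / n! is a single term of the exponential series at n, hence at most
  e^n.\<close>

lemma ln_fact_ge: "real n * ln (real n) - real n \<le> ln (fact n)"
proof (cases "n = 0")
  case False
  have "real n ^ n / fact n \<le> (\<Sum>k. real n ^ k / fact k)"
    using summable_exp[of "real n"] sum_le_suminf[of "\<lambda>k. real n ^ k / fact k" "{n}"]
    by (simp add: divide_inverse mult.commute)
  also have "\<dots> = exp (real n)"
    by (simp add: exp_def scaleR_conv_of_real divide_inverse mult.commute)
  finally have "ln (real n ^ n / fact n) \<le> ln (exp (real n))"
    using False by (subst ln_le_cancel_iff) auto
  then show ?thesis using False by (simp add: ln_div ln_realpow)
qed auto

lemma ln_fact_le: "ln (fact n) \<le> real n * ln (real n)"
proof (cases "n = 0")
  case False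
  have "ln (fact n :: real) \<le> ln (real n ^ n)"
    using fact_le_power[of n, where 'a = real] False
    by (subst ln_le_cancel_iff) auto
  then show ?thesis using False by (simp add: ln_realpow)
qed auto

text \<open>The denominator p - 1 sums ln p / p^k over all k >= 1. It fits Legendre's formula from
  above, and 1/(p - 1) also bounds -ln (1 - 1/p), the summand of \<open>mertens_sum\<close>.\<close>

definition ln_pred_sum :: "nat \<Rightarrow> real" where
  "ln_pred_sum n = (\<Sum>p\<in>primes_upto n. ln (real p) / (real p - 1))"

lemma ln_pred_sum_ge: assumes "n \<ge> 1" shows "ln (real n) - 1 \<le> ln_pred_sum n"
proof -
  have "real n * (ln (real n) - 1) \<le> ln (fact n)"
    using ln_fact_ge[of n] by (simp add: algebra_simps)
  also have "\<dots> = (\<Sum>p\<in>primes_upto n. real (multiplicity p (fact n :: nat)) * ln (real p))"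
    by (rule ln_fact_eq_sum_primes)
  also have "\<dots> \<le> (\<Sum>p\<in>primes_upto n. real n / (real p - 1) * ln (real p))"
    by (intro sum_mono mult_right_mono multiplicity_fact_le) (auto dest: primes_uptoD)
  also have "\<dots> = real n * ln_pred_sum n"
    by (simp add: ln_pred_sum_def sum_distrib_left)
  finally show ?thesis using assms by simp
qed

text \<open>Only the term k = 1 of Legendre's formula is kept. Removing the floor from n div p loses
  at most 1 per prime, in total the sum of ln p, which Chebyshev's bound controls.\<close>

lemma sum_ln_div_primes_le:
  assumes "n \<ge> 1"
  shows "(\<Sum>p\<in>primes_upto n. ln (real p) / real p) \<le> ln (real n) + ln 4"
proof -
  have "real n * (\<Sum>p\<in>primes_upto n. ln (real p) / real p) - (\<Sum>p\<in>primes_upto n. ln (real p))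
     = (\<Sum>p\<in>primes_upto n. (real n / real p - 1) * ln (real p))"
    by (simp add: sum_distrib_left sum_subtractf[symmetric] algebra_simps)
  also have "\<dots> \<le> (\<Sum>p\<in>primes_upto n. real (multiplicity p (fact n :: nat)) * ln (real p))"
  proof (intro sum_mono mult_right_mono)
    fix p assume p: "p \<in> primes_upto n"
    have "real n / real p - 1 \<le> real (n div p)"
    proof -
      have "real n < real p * (real (n div p) + 1)"
      proof -
        have "n < p * (n div p + 1)"
          using dividend_less_times_div[of p n] primes_uptoD(3)[OF p] by simp
        then have "real n < real (p * (n div p + 1))" by (simp only: of_nat_less_iff)
        then show ?thesis by (simp add: algebra_simps)
      qed
      then show ?thesis using primes_uptoD(3)[OF p] by (simp add: field_simps)
    qed
    also have "n div p = (\<Sum>k\<in>{1}. n div p ^ k)" by simp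
    also have "\<dots> \<le> (\<Sum>k=1..n. n div p ^ k)"
      using assms by (intro sum_mono2) auto
    also have "\<dots> = multiplicity p (fact n)"
      using p by (simp add: multiplicity_fact primes_uptoD)
    finally show "real n / real p - 1 \<le> real (multiplicity p (fact n :: nat))" by simp
  qed (auto dest: primes_uptoD)
  also have "\<dots> = ln (fact n)" by (rule ln_fact_eq_sum_primes[symmetric])
  also have "\<dots> \<le> real n * ln (real n)" by (rule ln_fact_le)
  finally have "real n * (\<Sum>p\<in>primes_upto n. ln (real p) / real p)
      \<le> real n * (ln (real n) + ln 4)"
    using sum_ln_primes_upto_le[of n] by (simp add: algebra_simps)
  then show ?thesis using assms by simp
qed

text \<open>Passing from p to p - 1 in the denominator changes each term by at most 4 p^(-3/2),
  which is summable.\<close>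

lemma ln_pred_sum_le: "\<exists>C. \<forall>n\<ge>1. ln_pred_sum n \<le> ln (real n) + C"
proof -
  define g :: "nat \<Rightarrow> real" where "g n = 4 * real n powr (-3/2)" for n
  have sg: "summable g"
    unfolding g_def by (intro summable_mult) (simp add: summable_real_powr_iff)
  have "ln_pred_sum n \<le> ln (real n) + (ln 4 + suminf g)" if n: "n \<ge> 1" for n
  proof -
    have "ln_pred_sum n - (\<Sum>p\<in>primes_upto n. ln (real p) / real p)
        = (\<Sum>p\<in>primes_upto n. ln (real p) / (real p - 1) - ln (real p) / real p)"
      by (simp add: ln_pred_sum_def sum_subtractf)
    also have "\<dots> \<le> (\<Sum>p\<in>primes_upto n. g p)"
    proof (rule sum_mono)
      fix p assume p: "p \<in> primes_upto n"
      define x where "x = real p"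
      have x: "x \<ge> 2" using primes_uptoD(3)[OF p] by (simp add: x_def)
      have "ln x = 2 * ln (sqrt x)" using x by (simp add: ln_sqrt)
      also have "\<dots> \<le> 2 * (sqrt x - 1)" using ln_le_minus_one[of "sqrt x"] x by simp
      finally have lx: "ln x \<le> 2 * sqrt x" by simp
      have "ln x / (x - 1) - ln x / x = ln x / (x * (x - 1))"
        using x by (simp add: field_simps)
      also have "\<dots> \<le> 2 * sqrt x / (x * (x / 2))"
        using x lx by (intro frac_le mult_left_mono mult_pos_pos) auto
      also have "\<dots> = 4 * (x powr (1/2) / x powr 2)"
        using x by (simp add: powr_half_sqrt power2_eq_square)
      also have "\<dots> = 4 * x powr (-3/2)"
        by (subst powr_diff[symmetric]) simp
      finally show "ln (real p) / (real p - 1) - ln (real p) / real p \<le> g p"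
        by (simp add: g_def x_def)
    qed
    also have "\<dots> \<le> suminf g"
      by (rule sum_le_suminf[OF sg]) (auto simp: g_def)
    finally show ?thesis using sum_ln_div_primes_le[OF n] by simp
  qed
  then show ?thesis by blast
qed

section \<open>Growth of the logarithm of Mertens' product\<close>

definition mertens_sum :: "nat \<Rightarrow> real" where
  "mertens_sum n = (\<Sum>p\<in>primes_upto n. - ln (1 - 1 / real p))"

lemma neg_ln_le:
  assumes "p \<ge> (2::nat)" shows "- ln (1 - 1 / real p) \<le> 1 / (real p - 1)"
proof -
  have "- ln (1 - 1 / real p) = ln (1 / (1 - 1 / real p))"
    using assms by (simp add: ln_div)
  also have "\<dots> \<le> 1 / (1 - 1 / real p) - 1"
    using assms by (intro ln_le_minus_one) (auto simp: field_simps)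
  also have "\<dots> = 1 / (real p - 1)" using assms by (simp add: field_simps)
  finally show ?thesis .
qed

lemma neg_ln_nonneg: "p \<ge> (2::nat) \<Longrightarrow> 0 \<le> - ln (1 - 1 / real p)"
  by (simp add: field_simps)

lemma ln_ln_diff_ge:
  assumes "0 < a" "a \<le> (b::real)" shows "(b - a) / b \<le> ln b - ln a"
proof -
  have "ln (a / b) \<le> a / b - 1" using assms by (intro ln_le_minus_one) auto
  then show ?thesis using assms by (simp add: ln_div diff_divide_distrib)
qed

text \<open>Partial summation against 1 / ln n, carried out as an induction on n. The remainder
  \<open>r\<close> of Mertens' first theorem is bounded, so it contributes O(1 / ln m) beyond the
  main term ln ln n - ln ln m.\<close>

lemma mertens_sum_diff_le:
  obtains C where "C > 0" "\<And>m n. 2 \<le> m \<Longrightarrow> m \<le> n \<Longrightarrow>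
     mertens_sum n - mertens_sum m \<le> ln (ln (real n)) - ln (ln (real m)) + C / ln (real m)"
proof -
  obtain C0 where C0: "\<And>n. n \<ge> 1 \<Longrightarrow> ln_pred_sum n \<le> ln (real n) + C0" using ln_pred_sum_le by blast
  define C where "C = max C0 1"
  define r where "r n = ln_pred_sum n - ln (real n)" for n
  have r1: "r n \<le> C" "- C \<le> r n" if "n \<ge> 1" for n
    using C0[OF that] ln_pred_sum_ge[OF that] by (auto simp: r_def C_def)
  have C: "C > 0" by (simp add: C_def)
  \<comment> \<open>The two quotients with \<open>r\<close> are the boundary terms of the partial
    summation; the last term bounds the accumulated differences of 1 / ln weighted by
    \<open>r\<close>.\<close>
  have main: "mertens_sum n - mertens_sum m \<le> ln (ln (real n)) - ln (ln (real m)) +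
      r n / ln (real n) - r m / ln (real m) + C * (1 / ln (real m) - 1 / ln (real n))"
    if "2 \<le> m" "m \<le> n" for m n
    using that(2)
  proof (induction n rule: dec_induct)
    case base
    then show ?case by simp
  next
    case (step n)
    define a where "a = ln (real n)"
    define b where "b = ln (real (Suc n))"
    have a: "0 < a" "a \<le> b" using step that by (auto simp: a_def b_def)
    \<comment> \<open>This is the increment of \<open>ln_pred_sum\<close>: for a prime p = n + 1 the
      denominator p - 1 is n.\<close>
    define s where "s = (if prime (Suc n) then b / real n else 0)"
    have s: "s = b - a + r (Suc n) - r n"
      by (simp add: s_def r_def ln_pred_sum_def sum_primes_upto_Suc a_def b_def)
    have "mertens_sum (Suc n) - mertens_sum n \<le> s / b"
      using neg_ln_le[of "Suc n"] step that a by (auto simp: mertens_sum_def sum_primes_upto_Suc s_def)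
    also have "\<dots> = (b - a) / b + r (Suc n) / b - r n / b"
      by (simp add: s add_divide_distrib diff_divide_distrib)
    also have "(b - a) / b \<le> ln b - ln a" using a by (intro ln_ln_diff_ge) auto
    finally have 1: "mertens_sum (Suc n) - mertens_sum n \<le> ln b - ln a + r (Suc n) / b - r n / b" by simp
    have "(r n - C) * (1 / a - 1 / b) \<le> 0"
      using a r1[of n] step that by (intro mult_nonpos_nonneg) (auto simp: frac_le)
    then have "r n / a - r n / b \<le> C * (1 / a - 1 / b)"
      by (simp add: algebra_simps)
    with 1 step.IH show ?case
      unfolding a_def[symmetric] b_def[symmetric] by (simp add: algebra_simps)
  qed
  show thesis
  proof (rule that[of "3 * C"])
    fix m n :: nat assume mn: "2 \<le> m" "m \<le> n"
    have pos: "0 < ln (real m)" "ln (real m) \<le> ln (real n)" using mn by auto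
    have "r n / ln (real n) \<le> C / ln (real n)"
      using pos r1[of n] mn by (intro divide_right_mono) auto
    moreover have "- r m / ln (real m) \<le> C / ln (real m)"
      using pos r1[of m] mn by (intro divide_right_mono) auto
    ultimately have "r n / ln (real n) - r m / ln (real m) + C * (1 / ln (real m) - 1 / ln (real n))
        \<le> C / ln (real m) + C / ln (real m)"
      by (simp add: right_diff_distrib)
    also have "\<dots> \<le> 3 * C / ln (real m)" using pos C by (simp add: field_simps)
    finally show "mertens_sum n - mertens_sum m \<le> ln (ln (real n)) - ln (ln (real m)) + 3 * C / ln (real m)"
      using main[OF mn] by simp
  qed (use C in simp)
qed


subsection \<open>Smooth numbers\<close>

text \<open>Parametrised by exponent vectors, because these index the terms of an expanded product
  of truncated geometric series.\<close>

definition smooth_nums :: "nat set \<Rightarrow> nat \<Rightarrow> nat set" where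
  "smooth_nums P K = (\<lambda>g. \<Prod>p\<in>P. p ^ g p) ` (P \<rightarrow>\<^sub>E {..K})"

lemma multiplicity_prod_primes:
  assumes "finite P" "\<And>p. p \<in> P \<Longrightarrow> prime (p::nat)" "p \<in> P"
  shows "multiplicity p (\<Prod>p\<in>P. p ^ g p) = g p"
proof -
  have "multiplicity p (\<Prod>p\<in>P. p ^ g p) = (\<Sum>r\<in>P. multiplicity p (r ^ g r))"
    using assms by (subst prime_elem_multiplicity_prod_distrib) (force dest: prime_gt_0_nat)+
  also have "\<dots> = (\<Sum>r\<in>P. if r = p then g p else 0)"
    using assms by (intro sum.cong)
      (auto simp: prime_multiplicity_other multiplicity_distinct_prime_power)
  finally show ?thesis using assms by simp
qed

text \<open>The truncated Euler product of a completely multiplicative function; unique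
  factorization makes the map from exponent vectors to integers injective. It serves both the real
  weights n^(-s) and the complex terms of a Dirichlet polynomial.\<close>

lemma prod_sum_powers:
  fixes F :: "nat \<Rightarrow> 'a :: comm_semiring_1"
  assumes P: "finite P" "\<And>p. p \<in> P \<Longrightarrow> prime p"
    and F: "F 1 = 1" "\<And>m n. m > 0 \<Longrightarrow> n > 0 \<Longrightarrow> F (m * n) = F m * F n"
  shows "(\<Prod>p\<in>P. \<Sum>k\<le>K. F p ^ k) = (\<Sum>n\<in>smooth_nums P K. F n)"
proof -
  have Fpow: "F (m ^ k) = F m ^ k" if "m > 0" for m k
    using that by (induction k) (use F in auto)
  have Fprod: "F (\<Prod>p\<in>Q. p ^ g p) = (\<Prod>p\<in>Q. F p ^ g p)" if "finite Q" "Q \<subseteq> P" for Q g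
    using that
  proof (induction Q rule: finite_induct)
    case (insert r Q)
    then have "(\<Prod>p\<in>Q. p ^ g p) > 0"
      by (intro prod_pos) (use P in \<open>auto dest: prime_gt_0_nat\<close>)
    with insert show ?case
      using P(2)[of r] by (auto simp: F(2) Fpow dest: prime_gt_0_nat)
  qed (use F in simp)
  have inj: "inj_on (\<lambda>g. \<Prod>p\<in>P. p ^ g p) (P \<rightarrow>\<^sub>E {..K})"
  proof (rule inj_onI)
    fix g h assume gh: "g \<in> P \<rightarrow>\<^sub>E {..K}" "h \<in> P \<rightarrow>\<^sub>E {..K}"
      "(\<Prod>p\<in>P. p ^ g p) = (\<Prod>p\<in>P. p ^ h p)"
    show "g = h"
    proof (rule PiE_ext[OF gh(1,2)])
      fix p assume "p \<in> P"
      then show "g p = h p"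
        using multiplicity_prod_primes[OF P, of p g] multiplicity_prod_primes[OF P, of p h] gh(3)
        by simp
    qed
  qed
  have "(\<Prod>p\<in>P. \<Sum>k\<le>K. F p ^ k) = (\<Sum>g\<in>P \<rightarrow>\<^sub>E {..K}. \<Prod>p\<in>P. F p ^ g p)"
    by (rule prod_sum_PiE) (use P in auto)
  also have "\<dots> = (\<Sum>g\<in>P \<rightarrow>\<^sub>E {..K}. F (\<Prod>p\<in>P. p ^ g p))"
    by (intro sum.cong refl) (simp add: Fprod P)
  also have "\<dots> = (\<Sum>n\<in>smooth_nums P K. F n)"
    unfolding smooth_nums_def using inj by (simp add: sum.reindex o_def)
  finally show ?thesis .
qed

lemma finite_smooth_nums: "finite P \<Longrightarrow> finite (smooth_nums P K)"
  unfolding smooth_nums_def by (intro finite_imageI finite_PiE) auto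

lemma smooth_nums_subset:
  assumes "\<And>p. p \<in> P \<Longrightarrow> prime p"
  shows "smooth_nums P K \<subseteq> {1..(\<Prod>P) ^ K}"
proof -
  have "1 \<le> (\<Prod>p\<in>P. p ^ g p)" "(\<Prod>p\<in>P. p ^ g p) \<le> (\<Prod>P) ^ K"
    if "g \<in> P \<rightarrow>\<^sub>E {..K}" for g
  proof -
    have pos: "0 < p" if "p \<in> P" for p using assms[OF that] by (rule prime_gt_0_nat)
    show "1 \<le> (\<Prod>p\<in>P. p ^ g p)"
      using prod_pos[of P "\<lambda>p. p ^ g p"] pos by (simp add: Suc_le_eq)
    show "(\<Prod>p\<in>P. p ^ g p) \<le> (\<Prod>P) ^ K"
      unfolding prod_power_distrib
      using that pos by (intro prod_mono) (auto intro!: power_increasing simp: Suc_le_eq PiE_iff)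
  qed
  then show ?thesis by (auto simp: smooth_nums_def)
qed

text \<open>The cap M on the exponents suffices because multiplicity p n < p^(multiplicity p n) <=
  n.\<close>

lemma atLeastAtMost_subset_smooth_nums: "{1..M} \<subseteq> smooth_nums (primes_upto M) M"
proof
  fix n assume n: "n \<in> {1..M}"
  define g where "g = restrict (\<lambda>p. multiplicity p n) (primes_upto M)"
  have "g \<in> primes_upto M \<rightarrow>\<^sub>E {..M}"
  proof (rule PiE_I)
    fix p assume p: "p \<in> primes_upto M"
    have "p ^ multiplicity p n \<le> n" using n by (intro dvd_imp_le multiplicity_dvd) auto
    moreover have "multiplicity p n < p ^ multiplicity p n"
      using primes_uptoD(3)[OF p] by (intro power_gt_expt) auto
    ultimately show "g p \<in> {..M}" using n p by (auto simp: g_def)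
  qed (auto simp: g_def)
  moreover have "n = (\<Prod>p\<in>primes_upto M. p ^ g p)"
  proof -
    have "n = (\<Prod>p\<in>prime_factors n. p ^ multiplicity p n)"
      using n by (subst prime_factorization_nat[symmetric]) auto
    also have "\<dots> = (\<Prod>p\<in>primes_upto M. p ^ multiplicity p n)"
    proof (rule prod.mono_neutral_left)
      show "prime_factors n \<subseteq> primes_upto M"
        using n by (auto simp: primes_upto_def prime_factors_dvd dest!: dvd_imp_le)
      show "\<forall>i\<in>primes_upto M - prime_factors n. i ^ multiplicity i n = 1"
        using n by (auto simp: primes_upto_def prime_factors_dvd not_dvd_imp_multiplicity_0)
    qed auto
    also have "\<dots> = (\<Prod>p\<in>primes_upto M. p ^ g p)"
      by (intro prod.cong) (auto simp: g_def)
    finally show ?thesis .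
  qed
  ultimately show "n \<in> smooth_nums (primes_upto M) M" unfolding smooth_nums_def by blast
qed

lemma sum_powr_le_prod_primes:
  assumes s: "s > 0"
  shows "(\<Sum>n=1..M. real n powr - s) \<le> (\<Prod>p\<in>primes_upto M. 1 / (1 - real p powr - s))"
proof -
  have "(\<Sum>n=1..M. real n powr - s) \<le> (\<Sum>n\<in>smooth_nums (primes_upto M) M. real n powr - s)"
    by (intro sum_mono2 atLeastAtMost_subset_smooth_nums finite_smooth_nums) auto
  also have "\<dots> = (\<Prod>p\<in>primes_upto M. \<Sum>k\<le>M. (real p powr - s) ^ k)"
    by (rule prod_sum_powers[symmetric]) (auto dest: primes_uptoD simp: powr_mult)
  also have "\<dots> \<le> (\<Prod>p\<in>primes_upto M. 1 / (1 - real p powr - s))"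
  proof (intro prod_mono conjI sum_nonneg)
    fix p assume p: "p \<in> primes_upto M"
    have y: "real p powr - s < 1" using primes_uptoD(3)[OF p] s by (simp add: powr_less_one)
    have "(\<Sum>k\<le>M. (real p powr - s) ^ k) \<le> (\<Sum>k. (real p powr - s) ^ k)"
      using y by (intro sum_le_suminf summable_geometric) auto
    also have "\<dots> = 1 / (1 - real p powr - s)" using y by (intro suminf_geometric) auto
    finally show "(\<Sum>k\<le>M. (real p powr - s) ^ k) \<le> 1 / (1 - real p powr - s)" .
  qed auto
  finally show ?thesis .
qed


subsection \<open>Mertens' third theorem (lower bound)\<close>

text \<open>Concavity of ln on the segment from 1 to 1 - y, with ln 1 = 0.\<close>

lemma mult_ln_le:
  assumes "0 \<le> y" "y < 1" "0 \<le> z" "z \<le> (1::real)"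
  shows "z * ln (1 - y) \<le> ln (1 - y * z)"
  using concave_onD[OF ln_concave, of z 1 "1 - y"] assms by (simp add: algebra_simps)

text \<open>The Euler product bounds the left side by a sum of -ln (1 - p^(-1-\<delta>)). Concavity,
  with y = 1/p and z = p^(-\<delta>), moves the perturbation out of the logarithm and turns it into
  a weight on the increments of \<open>mertens_sum\<close>.\<close>

lemma sum_primes_powr_ge:
  assumes d: "\<delta> > 0" and M: "M \<ge> 1"
  shows "ln (\<Sum>n=1..M. real n powr - (1 + \<delta>))
    \<le> (\<Sum>p\<in>primes_upto M. - ln (1 - 1 / real p) * real p powr - \<delta>)"
proof -
  have pos: "0 < (\<Sum>n=1..M. real n powr - (1 + \<delta>))"
    using M by (intro sum_pos) auto
  have lt1: "real p powr - (1 + \<delta>) < 1" if "p \<in> primes_upto M" for p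
    using primes_uptoD(3)[OF that] d by (simp add: powr_less_one)
  have "ln (\<Sum>n=1..M. real n powr - (1 + \<delta>))
      \<le> ln (\<Prod>p\<in>primes_upto M. 1 / (1 - real p powr - (1 + \<delta>)))"
  proof -
    have "0 < (\<Prod>p\<in>primes_upto M. 1 / (1 - real p powr - (1 + \<delta>)))"
      using lt1 by (intro prod_pos) auto
    then show ?thesis
      using pos sum_powr_le_prod_primes[of "1 + \<delta>" M] d by (subst ln_le_cancel_iff) auto
  qed
  also have "\<dots> = (\<Sum>p\<in>primes_upto M. ln (1 / (1 - real p powr - (1 + \<delta>))))"
  proof -
    have "1 / (1 - real p powr - (1 + \<delta>)) \<noteq> 0" if "p \<in> primes_upto M" for p
      using lt1[OF that] by simp
    then show ?thesis by (intro ln_prod) auto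
  qed
  also have "\<dots> \<le> (\<Sum>p\<in>primes_upto M. - ln (1 - 1 / real p) * real p powr - \<delta>)"
  proof (rule sum_mono)
    fix p assume p: "p \<in> primes_upto M"
    have p2: "p \<ge> 2" using primes_uptoD(3)[OF p] .
    have "real p powr - (1 + \<delta>) = real p powr - 1 * real p powr - \<delta>"
      by (subst powr_add[symmetric]) simp
    then have "real p powr - (1 + \<delta>) = 1 / real p * real p powr - \<delta>"
      by (simp add: powr_minus divide_inverse)
    moreover have "real p powr - \<delta> * ln (1 - 1 / real p) \<le> ln (1 - 1 / real p * real p powr - \<delta>)"
      using p2 d by (intro mult_ln_le) (auto simp: powr_le_one_le powr_mono_both
        intro!: less_imp_le[OF powr_less_one])
    moreover have "ln (1 / (1 - real p powr - (1 + \<delta>))) = - ln (1 - real p powr - (1 + \<delta>))"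
      using lt1[OF p] by (subst ln_div) auto
    ultimately show "ln (1 / (1 - real p powr - (1 + \<delta>))) \<le> - ln (1 - 1 / real p) * real p powr - \<delta>"
      by (simp only: mult_minus_left mult.commute[of "ln _"])
  qed
  finally show ?thesis .
qed

text \<open>A discrete form of the integral test: n^(-\<delta>) - (n+1)^(-\<delta>) is at most
  \<delta> n^(-1-\<delta>), and the left side telescopes.\<close>

lemma sum_powr_ge:
  assumes d: "\<delta> > 0"
  shows "(1 - real (M + 1) powr - \<delta>) / \<delta> \<le> (\<Sum>n=1..M. real n powr - (1 + \<delta>))"
proof -
  have "(real n powr - \<delta> - real (n + 1) powr - \<delta>) / \<delta> \<le> real n powr - (1 + \<delta>)" if "n \<ge> 1" for n
  proof -
    have "1 - \<delta> / real n \<le> 1 - \<delta> * ln (1 + 1 / real n)"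
      using ln_add_one_self_le_self[of "1 / real n"] that d
      by (simp add: mult_left_mono[of _ _ \<delta>, of _ "1 / real n", simplified])
    also have "\<dots> \<le> exp (- \<delta> * ln (1 + 1 / real n))"
      using exp_ge_add_one_self[of "- \<delta> * ln (1 + 1 / real n)"] by simp
    also have "\<dots> = (1 + 1 / real n) powr - \<delta>"
      using that by (simp add: powr_def add_nonneg_eq_0_iff)
    finally have "real n powr - \<delta> * (1 - (1 + 1 / real n) powr - \<delta>) \<le> real n powr - \<delta> * (\<delta> / real n)"
      by (intro mult_left_mono) auto
    also have "real n powr - \<delta> * (1 - (1 + 1 / real n) powr - \<delta>)
       = real n powr - \<delta> - (real n * (1 + 1 / real n)) powr - \<delta>"
      by (simp add: powr_mult right_diff_distrib)
    also have "real n * (1 + 1 / real n) = real (n + 1)" using that by (simp add: field_simps)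
    also have "real n powr - \<delta> * (\<delta> / real n) = \<delta> * real n powr - (1 + \<delta>)"
    proof -
      have "real n powr - (1 + \<delta>) = real n powr - 1 * real n powr - \<delta>"
        by (subst powr_add[symmetric]) simp
      also have "real n powr - 1 = inverse (real n)" by (simp add: powr_minus)
      finally show ?thesis by (simp add: divide_inverse mult.commute)
    qed
    finally show ?thesis using d by (simp add: field_simps)
  qed
  then have "(\<Sum>n=1..M. (real n powr - \<delta> - real (n + 1) powr - \<delta>) / \<delta>)
      \<le> (\<Sum>n=1..M. real n powr - (1 + \<delta>))"
    by (intro sum_mono) auto
  moreover have "(\<Sum>n=1..M. (real n powr - \<delta> - real (n + 1) powr - \<delta>) / \<delta>)
      = (1 - real (M + 1) powr - \<delta>) / \<delta>"
  proof (induction M)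
    case (Suc M)
    then show ?case using d by (simp add: field_simps)
  qed simp
  ultimately show ?thesis by simp
qed

text \<open>Since \<open>ln 0 = 0\<close>, also \<open>harm_ln 0 = 0\<close>, so the telescoping sums below may start at \<open>0\<close>.\<close>
definition harm_ln :: "nat \<Rightarrow> real" where
  "harm_ln n = harm (nat \<lfloor>ln (real n)\<rfloor>)"

text \<open>The function \<open>harm_ln\<close> gains 1/i at the first integer n >= e^i, where the
  weight n^(-\<delta>) is at most e^(-\<delta> i). What results is a partial sum of the logarithmic
  series at e^(-\<delta>).\<close>

lemma sum_harm_ln_powr_le:
  assumes d: "\<delta> > 0"
  shows "(\<Sum>n=1..M. (harm_ln n - harm_ln (n - 1)) * real n powr - \<delta>) \<le> - ln (1 - exp (- \<delta>))"
proof -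
  define k where "k n = nat \<lfloor>ln (real n)\<rfloor>" for n :: nat
  define Q where "Q m = (\<Sum>i=1..m. exp (- \<delta>) ^ i / real i)" for m :: nat
  have "(harm_ln n - harm_ln (n - 1)) * real n powr - \<delta> \<le> Q (k n) - Q (k (n - 1))" if n: "n \<ge> 1" for n
  proof -
    have kk: "k (n - 1) \<le> k n"
      using n by (cases "n = 1") (auto simp: k_def intro!: nat_mono floor_mono)
    have un: "{1..k n} = {1..k (n - 1)} \<union> {k (n - 1)<..k n}" using kk by auto
    have dif: "(\<Sum>i=1..k n. f i) - (\<Sum>i=1..k (n - 1). f i) = (\<Sum>i\<in>{k (n - 1)<..k n}. f i)"
      for f :: "nat \<Rightarrow> real"
      unfolding un by (subst sum.union_disjoint) auto
    have "(harm_ln n - harm_ln (n - 1)) * real n powr - \<delta>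
        = (\<Sum>i\<in>{k (n - 1)<..k n}. inverse (real i) * real n powr - \<delta>)"
      by (simp only: harm_ln_def harm_def k_def[symmetric] dif sum_distrib_right)
    also have "\<dots> \<le> (\<Sum>i\<in>{k (n - 1)<..k n}. exp (- \<delta>) ^ i / real i)"
    proof (rule sum_mono)
      fix i assume i: "i \<in> {k (n - 1)<..k n}"
      have "real i \<le> real (k n)" using i by simp
      also have "\<dots> \<le> ln (real n)" using n by (simp add: k_def)
      finally have "- \<delta> * ln (real n) \<le> - \<delta> * real i" using d by simp
      then have "real n powr - \<delta> \<le> exp (- \<delta>) ^ i"
        using n by (simp add: powr_def exp_of_nat_mult[symmetric] mult.commute)
      then show "inverse (real i) * real n powr - \<delta> \<le> exp (- \<delta>) ^ i / real i"
        by (simp add: divide_inverse mult.commute mult_left_mono)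
    qed
    also have "\<dots> = Q (k n) - Q (k (n - 1))" by (simp only: Q_def dif)
    finally show ?thesis .
  qed
  then have "(\<Sum>n=1..M. (harm_ln n - harm_ln (n - 1)) * real n powr - \<delta>)
      \<le> (\<Sum>n=1..M. Q (k n) - Q (k (n - 1)))"
    by (intro sum_mono) auto
  also have "\<dots> = Q (k M) - Q (k 0)" by (induction M) auto
  also have "\<dots> \<le> Q (k M)" by (simp add: Q_def k_def)
  also have "\<dots> \<le> - ln (1 - exp (- \<delta>))"
  proof -
    have "(\<lambda>n. - ((- (- exp (- \<delta>))) ^ n) / of_nat n) sums ln (1 + (- exp (- \<delta>)))"
      using d by (intro Complex_Transcendental.ln_series') auto
    from sums_minus[OF this]
    have "(\<lambda>n. exp (- \<delta>) ^ n / real n) sums (- ln (1 - exp (- \<delta>)))" by simp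
    then show ?thesis
      using sum_le_suminf[of "\<lambda>n. exp (- \<delta>) ^ n / real n" "{1..k M}"]
      by (simp add: Q_def sums_iff)
  qed
  finally show ?thesis .
qed

text \<open>Abel summation with decreasing weights: up to m the bound K is used for f, from m on the
  bound -\<eta>.\<close>

lemma weighted_sum_le:
  fixes f w :: "nat \<Rightarrow> real"
  assumes f0: "f 0 = 0" and K: "\<And>n. f n \<le> K" and \<eta>: "\<And>n. n \<ge> m \<Longrightarrow> f n \<le> - \<eta>"
    and w: "\<And>n. 0 \<le> w n" "\<And>n. n \<ge> 1 \<Longrightarrow> w (Suc n) \<le> w n"
    and m: "1 \<le> m" "m \<le> M"
  shows "(\<Sum>n=1..M. (f n - f (n - 1)) * w n) \<le> K * (w 1 - w m) - \<eta> * w m"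
proof -
  have 1: "(\<Sum>n=1..N. (f n - f (n - 1)) * w n) \<le> f N * w N + K * (w 1 - w N)" if "1 \<le> N" for N
    using that
  proof (induction N rule: dec_induct)
    case (step n)
    have "(f n - K) * (w n - w (Suc n)) \<le> 0"
      using K[of n] w(2)[of n] step by (intro mult_nonpos_nonneg) auto
    with step show ?case by (simp add: algebra_simps)
  qed (simp add: f0)
  have "(\<Sum>n=1..M. (f n - f (n - 1)) * w n) \<le> f M * w M + K * (w 1 - w m) - \<eta> * (w m - w M)"
    using m(2)
  proof (induction M rule: dec_induct)
    case base
    then show ?case using 1[OF m(1)] by simp
  next
    case (step n)
    have "(f n + \<eta>) * (w n - w (Suc n)) \<le> 0"
      using \<eta>[of n] w(2)[of n] step m by (intro mult_nonpos_nonneg) auto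
    with step show ?case by (simp add: algebra_simps)
  qed
  moreover have "f M * w M \<le> - \<eta> * w M"
    using \<eta>[of M] w(1)[of M] m by (intro mult_right_mono) auto
  ultimately show ?thesis by (simp add: algebra_simps)
qed

lemma mertens_sum_mono: "m \<le> n \<Longrightarrow> mertens_sum m \<le> mertens_sum n"
  unfolding mertens_sum_def
  by (intro sum_mono2 neg_ln_nonneg) (auto simp: primes_upto_def intro!: prime_ge_2_nat)

text \<open>As \<delta> tends to 0 the weights n^(-\<delta>) tend to 1. The head of the sum then
  contributes K (1 - m^(-\<delta>)), which vanishes, while the tail keeps the deficit -\<eta>. The
  lower bound from zeta tends to 0, which would give 0 <= -\<eta>.\<close>

lemma not_eventually_mertens_sum_le:
  assumes "\<eta> > 0" "m \<ge> 1" "\<And>n. n \<ge> m \<Longrightarrow> mertens_sum n \<le> harm_ln n - \<eta>"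
  shows False
proof -
  define f where "f n = mertens_sum n - harm_ln n" for n
  \<comment> \<open>A bound for f everywhere: before m by monotonicity and \<open>harm_ln\<close> >=
    0, from m on because f is negative there.\<close>
  define K where "K = mertens_sum m"
  have f\<eta>: "f n \<le> - \<eta>" if "n \<ge> m" for n using assms(3)[OF that] by (simp add: f_def)
  have hn: "harm_ln n \<ge> 0" for n by (simp add: harm_ln_def harm_nonneg)
  have K0: "0 \<le> K" using mertens_sum_mono[of 0 m] by (simp add: K_def mertens_sum_def)
  have fK: "f n \<le> K" for n
  proof (cases "n \<ge> m")
    case True
    then show ?thesis using f\<eta>[OF True] K0 assms(1) by simp
  next
    case False
    then show ?thesis using mertens_sum_mono[of n m] hn[of n] by (simp add: f_def K_def)
  qed
  have ineq: "ln (1 / \<delta>) + ln (1 - exp (- \<delta>)) \<le> K * (1 - real m powr - \<delta>) - \<eta> * real m powr - \<delta>"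
    if d: "\<delta> > 0" for \<delta>
  proof -
    have bnd: "ln ((1 - real (M + 1) powr - \<delta>) / \<delta>) + ln (1 - exp (- \<delta>))
        \<le> K * (1 - real m powr - \<delta>) - \<eta> * real m powr - \<delta>" if M: "M \<ge> m" for M
    proof -
      have M1: "M \<ge> 1" using M assms by simp
      have "(\<Sum>n=1..M. (f n - f (n - 1)) * real n powr - \<delta>)
          \<le> K * (real 1 powr - \<delta> - real m powr - \<delta>) - \<eta> * real m powr - \<delta>"
        by (rule weighted_sum_le[OF _ fK f\<eta>])
           (use assms M d in \<open>auto simp: f_def mertens_sum_def harm_ln_def harm_def intro!: powr_mono2'\<close>)
      moreover have "(\<Sum>n=1..M. (f n - f (n - 1)) * real n powr - \<delta>)
         = (\<Sum>n=1..M. (mertens_sum n - mertens_sum (n - 1)) * real n powr - \<delta>)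
         - (\<Sum>n=1..M. (harm_ln n - harm_ln (n - 1)) * real n powr - \<delta>)"
        by (simp add: f_def sum_subtractf[symmetric] algebra_simps)
      moreover have "(\<Sum>n=1..M. (mertens_sum n - mertens_sum (n - 1)) * real n powr - \<delta>)
         = (\<Sum>p\<in>primes_upto M. - ln (1 - 1 / real p) * real p powr - \<delta>)"
        by (induction M) (auto simp: mertens_sum_def sum_primes_upto_Suc)
      moreover have "ln ((1 - real (M + 1) powr - \<delta>) / \<delta>) \<le> ln (\<Sum>n=1..M. real n powr - (1 + \<delta>))"
      proof -
        have "0 < (1 - real (M + 1) powr - \<delta>) / \<delta>"
          using d M1 by (auto simp: powr_less_one)
        then show ?thesis using sum_powr_ge[OF d, of M] by (subst ln_le_cancel_iff) auto
      qed
      ultimately show ?thesis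
        using sum_primes_powr_ge[OF d M1] sum_harm_ln_powr_le[OF d, of M] by simp
    qed
    \<comment> \<open>First M tends to infinity for fixed \<delta>; only afterwards does \<delta>
      tend to 0.\<close>
    have "(\<lambda>M. ln ((1 - real (M + 1) powr - \<delta>) / \<delta>) + ln (1 - exp (- \<delta>)))
        \<longlonglongrightarrow> ln ((1 - 0) / \<delta>) + ln (1 - exp (- \<delta>))"
    proof (intro tendsto_intros)
      show "(\<lambda>M. real (M + 1) powr - \<delta>) \<longlonglongrightarrow> 0"
        using d by real_asymp
    qed (use d in auto)
    then show ?thesis
      using bnd by (intro tendsto_upperbound[of _ _ sequentially])
        (auto intro!: eventually_sequentiallyI[of m])
  qed
  have "((\<lambda>\<delta>::real. ln (1 / \<delta>) + ln (1 - exp (- \<delta>))) \<longlongrightarrow> 0) (at_right 0)"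
    by real_asymp
  moreover have "((\<lambda>\<delta>. K * (1 - real m powr - \<delta>) - \<eta> * real m powr - \<delta>)
      \<longlongrightarrow> K * (1 - real m powr - 0) - \<eta> * real m powr - 0) (at_right 0)"
    using assms(2) by (intro tendsto_intros) auto
  ultimately have "0 \<le> K * (1 - real m powr - 0) - \<eta> * real m powr - 0"
    by (intro tendsto_le[OF _ _ \<open>((\<lambda>\<delta>::real. ln (1 / \<delta>) + ln (1 - exp (- \<delta>))) \<longlongrightarrow> 0) (at_right 0)\<close>])
       (auto simp: eventually_at_filter intro!: always_eventually ineq)
  then show False using assms by simp
qed

text \<open>The one-sided increment bound makes a deficit permanent: if the claim fails at one m,
  then \<open>mertens_sum\<close> stays below ln ln n + gamma by a fixed amount for all n >= m,
  which the comparison with \<open>harm_ln\<close> excludes.\<close>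

lemma mertens_sum_ge:
  obtains C where "C > 0" "\<And>n. 2 \<le> n \<Longrightarrow>
     mertens_sum n \<ge> ln (ln (real n)) + euler_mascheroni - C / ln (real n)"
proof -
  obtain C where C: "C > 0" "\<And>m n. 2 \<le> m \<Longrightarrow> m \<le> n \<Longrightarrow>
     mertens_sum n - mertens_sum m \<le> ln (ln (real n)) - ln (ln (real m)) + C / ln (real m)"
    using mertens_sum_diff_le by metis
  have "mertens_sum m \<ge> ln (ln (real m)) + euler_mascheroni - C / ln (real m)" if m: "2 \<le> m" for m
  proof (rule ccontr)
    assume neg: "\<not> ?thesis"
    \<comment> \<open>Half of the deficit: one \<eta> is spent on the convergence of the harmonic
      numbers, the other remains for the contradiction.\<close>
    define \<eta> where "\<eta> = (ln (ln (real m)) + euler_mascheroni - C / ln (real m) - mertens_sum m) / 2"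
    have \<eta>: "\<eta> > 0" using neg by (simp add: \<eta>_def)
    have A: "mertens_sum n \<le> ln (ln (real n)) + euler_mascheroni - 2 * \<eta>" if "n \<ge> m" for n
      using C(2)[OF m that] unfolding \<eta>_def by argo
    \<comment> \<open>With k the floor of ln n, only ln n < k + 1 is available, so the harmonic
      number is compared with ln (k + 1).\<close>
    have "(\<lambda>n. harm n - ln (real (Suc n))) \<longlonglongrightarrow> euler_mascheroni"
    proof -
      have "(\<lambda>n. harm n - ln (real n) - (ln (real (Suc n)) - ln (real n))) \<longlonglongrightarrow> euler_mascheroni - 0"
        by (intro tendsto_diff euler_mascheroni_LIMSEQ) real_asymp
      then show ?thesis by simp
    qed
    then have "\<forall>\<^sub>F n in sequentially. euler_mascheroni - \<eta> < harm n - ln (real (Suc n))"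
      using \<eta> by (intro order_tendstoD(1)) auto
    then obtain k0 where k0: "\<And>k. k \<ge> k0 \<Longrightarrow> euler_mascheroni - \<eta> < harm k - ln (real (Suc k))"
      by (auto simp: eventually_sequentially)
    define m1 where "m1 = max m (nat \<lceil>exp (real k0)\<rceil>)"
    show False
    proof (rule not_eventually_mertens_sum_le[OF \<eta>, of m1])
      show "m1 \<ge> 1" using m by (simp add: m1_def)
      fix n assume n: "m1 \<le> n"
      then have nm: "n \<ge> m" and "exp (real k0) \<le> real n" unfolding m1_def by linarith+
      then have ln0: "real k0 \<le> ln (real n)" using m by (simp add: ln_ge_iff)
      define k where "k = nat \<lfloor>ln (real n)\<rfloor>"
      have "k \<ge> k0" using ln0 by (simp add: k_def le_nat_floor)
      moreover have "ln (ln (real n)) \<le> ln (real (Suc k))"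
      proof -
        have "ln (real n) \<le> real (Suc k)" using ln0 unfolding k_def by linarith
        moreover have "ln (real n) > 0" using nm m by simp
        ultimately show ?thesis by (subst ln_le_cancel_iff) auto
      qed
      ultimately show "mertens_sum n \<le> harm_ln n - \<eta>"
        using k0[of k] A[OF nm] by (simp add: harm_ln_def k_def)
    qed
  qed
  with C(1) show thesis using that by blast
qed

subsection \<open>Positive trigonometric series\<close>

text \<open>Trigonometric series with nonnegative coefficients and arbitrary real frequencies, given
  by closure rules. Positivity statements follow by rule induction, so coefficients never have to be
  named, and the limit rule admits infinite series such as the resonator.\<close>

inductive trig_pos :: "(real \<Rightarrow> complex) \<Rightarrow> bool" where
  trig_pos_cis: "trig_pos (\<lambda>t. cis (c * t))"
| trig_pos_add: "trig_pos f \<Longrightarrow> trig_pos g \<Longrightarrow> trig_pos (\<lambda>t. f t + g t)"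
| trig_pos_scale: "0 \<le> a \<Longrightarrow> trig_pos f \<Longrightarrow> trig_pos (\<lambda>t. of_real a * f t)"
| trig_pos_lim: "(\<And>n::nat. trig_pos (F n)) \<Longrightarrow> (\<And>t. (\<lambda>n. F n t) \<longlonglongrightarrow> f t) \<Longrightarrow> trig_pos f"

lemma trig_pos_1: "trig_pos (\<lambda>t. 1)"
  using trig_pos_cis[of 0] by simp

lemma trig_pos_const: "0 \<le> a \<Longrightarrow> trig_pos (\<lambda>t. of_real a)"
  using trig_pos_scale[OF _ trig_pos_1] by simp

lemma trig_pos_0: "trig_pos (\<lambda>t. 0)"
  using trig_pos_const[of 0] by simp

lemma trig_pos_mult:
  assumes "trig_pos f" "trig_pos g" shows "trig_pos (\<lambda>t. f t * g t)"
  using assms(1)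
proof (induction rule: trig_pos.induct)
  case (trig_pos_cis c)
  show ?case using assms(2)
  proof (induction rule: trig_pos.induct)
    case (trig_pos_cis d)
    then show ?case using trig_pos.trig_pos_cis[of "c + d"] by (simp add: cis_mult algebra_simps)
  next
    case (trig_pos_add f g)
    then show ?case using trig_pos.trig_pos_add[of "\<lambda>t. cis (c * t) * f t" "\<lambda>t. cis (c * t) * g t"] by (simp add: algebra_simps)
  next
    case (trig_pos_scale a f)
    then show ?case using trig_pos.trig_pos_scale[of a "\<lambda>t. cis (c * t) * f t"] by (simp add: algebra_simps)
  next
    case (trig_pos_lim F f)
    show ?case by (rule trig_pos.trig_pos_lim[where F = "\<lambda>n t. cis (c * t) * F n t"])
      (use trig_pos_lim in \<open>auto intro!: tendsto_intros\<close>)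
  qed
next
  case (trig_pos_add f h)
  then show ?case using trig_pos.trig_pos_add[of "\<lambda>t. f t * g t" "\<lambda>t. h t * g t"] by (simp add: algebra_simps)
next
  case (trig_pos_scale a f)
  then show ?case using trig_pos.trig_pos_scale[of a "\<lambda>t. f t * g t"] by (simp add: algebra_simps)
next
  case (trig_pos_lim F f)
  show ?case by (rule trig_pos.trig_pos_lim[where F = "\<lambda>n t. F n t * g t"])
    (use trig_pos_lim in \<open>auto intro!: tendsto_intros\<close>)
qed

lemma trig_pos_sum: "(\<And>i. i \<in> I \<Longrightarrow> trig_pos (f i)) \<Longrightarrow> trig_pos (\<lambda>t. \<Sum>i\<in>I. f i t)"
  by (induction I rule: infinite_finite_induct) (auto intro: trig_pos_0 trig_pos_add)

lemma trig_pos_prod: "(\<And>i. i \<in> I \<Longrightarrow> trig_pos (f i)) \<Longrightarrow> trig_pos (\<lambda>t. \<Prod>i\<in>I. f i t)"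
  by (induction I rule: infinite_finite_induct) (auto intro: trig_pos_1 trig_pos_mult)

lemma trig_pos_power: "trig_pos f \<Longrightarrow> trig_pos (\<lambda>t. f t ^ n)"
  by (induction n) (auto intro: trig_pos_1 trig_pos_mult)

lemma trig_pos_geometric:
  assumes "0 \<le> q" "q < 1"
  shows "trig_pos (\<lambda>t. 1 / (1 - of_real q * cis (c * t)))"
proof (rule trig_pos_lim[where F = "\<lambda>n t. \<Sum>k<n. (of_real q * cis (c * t)) ^ k"])
  show "trig_pos (\<lambda>t. \<Sum>k<n. (of_real q * cis (c * t)) ^ k)" for n
    by (intro trig_pos_sum trig_pos_power trig_pos_scale trig_pos_cis assms)
  show "(\<lambda>n. \<Sum>k<n. (of_real q * cis (c * t)) ^ k) \<longlonglongrightarrow> 1 / (1 - of_real q * cis (c * t))" for t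
    using geometric_sums[of "of_real q * cis (c * t)"] assms
    by (simp add: sums_def norm_mult)
qed

text \<open>For \<open>f t = cis (c * t)\<close> the double sum is a Fejer kernel, i.e. the squared modulus of
  \<open>\<Sum>a<m. cis (c * h * a)\<close>.\<close>
lemma Re_sum_trig_pos_nonneg:
  assumes "trig_pos f"
  shows "0 \<le> (\<Sum>a<m. \<Sum>b<m. Re (f (h * (real a - real b))))"
  using assms
proof (induction rule: trig_pos.induct)
  case (trig_pos_cis c)
  define S where "S = (\<Sum>a<m. cis (c * h * real a))"
  have "(\<Sum>a<m. \<Sum>b<m. cis (c * (h * (real a - real b))))
      = (\<Sum>a<m. \<Sum>b<m. cis (c * h * real a) * cnj (cis (c * h * real b)))"
    by (intro sum.cong refl) (simp add: cis_cnj cis_mult algebra_simps)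
  also have "\<dots> = S * cnj S" by (simp add: S_def sum_product)
  also have "\<dots> = of_real ((cmod S)\<^sup>2)" by (simp only: complex_norm_square)
  finally have "Re (\<Sum>a<m. \<Sum>b<m. cis (c * (h * (real a - real b)))) = (cmod S)\<^sup>2"
    by (metis Re_complex_of_real)
  then show ?case by simp
next
  case (trig_pos_add f g)
  then show ?case by (simp add: sum.distrib)
next
  case (trig_pos_scale a f)
  then show ?case by (simp add: sum_distrib_left[symmetric])
next
  case (trig_pos_lim F f)
  show ?case
  proof (rule tendsto_lowerbound)
    show "(\<lambda>n. \<Sum>a<m. \<Sum>b<m. Re (F n (h * (real a - real b))))
        \<longlonglongrightarrow> (\<Sum>a<m. \<Sum>b<m. Re (f (h * (real a - real b))))"
      by (intro tendsto_intros trig_pos_lim)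
  qed (use trig_pos_lim in auto)
qed

subsection \<open>Domination relative to a resonator\<close>

text \<open>Multiplication by f acts on R at least like the scalar c, coefficient by coefficient.
  Nonnegativity of f and c is included so that the relation is closed under products.\<close>

definition dominates :: "(real \<Rightarrow> complex) \<Rightarrow> (real \<Rightarrow> complex) \<Rightarrow> real \<Rightarrow> bool" where
  "dominates R f c \<longleftrightarrow> trig_pos f \<and> 0 \<le> c \<and> trig_pos (\<lambda>t. f t * R t - of_real c * R t)"

lemma dominates_1: "dominates R (\<lambda>t. 1) 1"
  by (simp add: dominates_def trig_pos_0 trig_pos_1)

lemma dominates_0: "dominates R (\<lambda>t. 0) 0"
  by (simp add: dominates_def trig_pos_0)

lemma dominates_add:
  assumes "dominates R f c" "dominates R g d"
  shows "dominates R (\<lambda>t. f t + g t) (c + d)"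
  using assms trig_pos_add[of "\<lambda>t. f t * R t - of_real c * R t" "\<lambda>t. g t * R t - of_real d * R t"]
  by (auto simp: dominates_def algebra_simps intro: trig_pos_add)

lemma dominates_scale:
  assumes "dominates R f c" "0 \<le> a"
  shows "dominates R (\<lambda>t. of_real a * f t) (a * c)"
  using assms trig_pos_scale[of a "\<lambda>t. f t * R t - of_real c * R t"]
  by (auto simp: dominates_def algebra_simps intro: trig_pos_scale)

lemma dominates_mult:
  assumes "dominates R f c" "dominates R g d"
  shows "dominates R (\<lambda>t. f t * g t) (c * d)"
proof -
  \<comment> \<open>The identity behind it is f g R - c d R = f (g R - d R) + d (f R - c R).\<close>
  have "trig_pos (\<lambda>t. f t * (g t * R t - of_real d * R t) + of_real d * (f t * R t - of_real c * R t))"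
    using assms by (auto simp: dominates_def intro!: trig_pos_add trig_pos_mult[of f] trig_pos_scale[of d])
  then show ?thesis using assms by (simp add: dominates_def trig_pos_mult algebra_simps)
qed

lemma dominates_sum:
  "(\<And>i. i \<in> I \<Longrightarrow> dominates R (f i) (c i)) \<Longrightarrow> dominates R (\<lambda>t. \<Sum>i\<in>I. f i t) (\<Sum>i\<in>I. c i)"
  by (induction I rule: infinite_finite_induct) (auto intro: dominates_0 dominates_add)

lemma dominates_prod:
  "(\<And>i. i \<in> I \<Longrightarrow> dominates R (f i) (c i)) \<Longrightarrow> dominates R (\<lambda>t. \<Prod>i\<in>I. f i t) (\<Prod>i\<in>I. c i)"
  by (induction I rule: infinite_finite_induct) (auto intro: dominates_1 dominates_mult)

lemma dominates_power: "dominates R f c \<Longrightarrow> dominates R (\<lambda>t. f t ^ n) (c ^ n)"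
  by (induction n) (auto intro: dominates_1 dominates_mult)

lemma dominates_mono:
  assumes "dominates R f c" "trig_pos (\<lambda>t. g t - f t)" "trig_pos R"
  shows "dominates R g c"
proof -
  have "trig_pos (\<lambda>t. (g t - f t) * R t + (f t * R t - of_real c * R t))"
    using assms by (intro trig_pos_add trig_pos_mult) (auto simp: dominates_def)
  moreover have "trig_pos (\<lambda>t. (g t - f t) + f t)"
    using assms by (intro trig_pos_add) (auto simp: dominates_def)
  ultimately show ?thesis using assms by (simp add: dominates_def algebra_simps)
qed

text \<open>The sign c = 1 gives R and c = -1 its complex conjugate, so one positivity proof covers
  both.\<close>

definition resonator :: "real \<Rightarrow> nat set \<Rightarrow> (nat \<Rightarrow> real) \<Rightarrow> real \<Rightarrow> complex" where
  "resonator c P q t = (\<Prod>p\<in>P. 1 / (1 - of_real (q p) * cis (c * ln (real p) * t)))"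

lemma trig_pos_resonator:
  assumes "\<And>p. p \<in> P \<Longrightarrow> 0 \<le> q p \<and> q p < 1"
  shows "trig_pos (resonator c P q)"
  unfolding resonator_def by (intro trig_pos_prod trig_pos_geometric) (use assms in auto)

text \<open>Since p^(-it) - q_p = p^(-it) (1 - q_p p^(it)), the difference cancels the factor of R
  at p. What remains is p^(-it) times the resonator over the other primes.\<close>

lemma dominates_prime:
  assumes P: "finite P" "p \<in> P" and q: "\<And>p. p \<in> P \<Longrightarrow> 0 \<le> q p \<and> q p < 1"
  shows "dominates (resonator 1 P q) (\<lambda>t. cis (- ln (real p) * t)) (q p)"
proof -
  define R' where "R' = resonator 1 (P - {p}) q"
  have "cis (- ln (real p) * t) * resonator 1 P q t - of_real (q p) * resonator 1 P q t
      = cis (- ln (real p) * t) * R' t" for t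
  proof -
    define z where "z = cis (ln (real p) * t)"
    have z: "z * cis (- ln (real p) * t) = 1" by (simp add: z_def cis_mult)
    have "norm (of_real (q p) * z) < 1" using q[OF P(2)] by (simp add: z_def norm_mult)
    then have ne: "1 - of_real (q p) * z \<noteq> 0" by auto
    have R: "resonator 1 P q t = 1 / (1 - of_real (q p) * z) * R' t"
      unfolding resonator_def R'_def z_def using P by (subst prod.remove[of P p]) auto
    have "cis (- ln (real p) * t) - of_real (q p) = cis (- ln (real p) * t) * (1 - of_real (q p) * z)"
      using z by (simp add: algebra_simps)
    then have "(cis (- ln (real p) * t) - of_real (q p)) * (1 / (1 - of_real (q p) * z))
        = cis (- ln (real p) * t)"
      using ne by simp
    then show ?thesis unfolding R by (metis left_diff_distrib mult.assoc)
  qed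
  moreover have "trig_pos (\<lambda>t. cis (- ln (real p) * t) * R' t)"
    unfolding R'_def by (intro trig_pos_mult trig_pos_cis trig_pos_resonator) (use q in auto)
  ultimately show ?thesis
    using q[OF P(2)] trig_pos_cis[of "- ln (real p)"] by (simp add: dominates_def)
qed

definition dpoly :: "nat \<Rightarrow> nat \<Rightarrow> real \<Rightarrow> complex" where
  "dpoly N j t = (\<Sum>n=1..N. of_real (1 / real n) * cis (- (real j * ln (real n)) * t))"

lemma trig_pos_dpoly_summand: "trig_pos (\<lambda>t. of_real (1 / real n) * cis (- (real j * ln (real n)) * t))"
  by (rule trig_pos_scale[OF _ trig_pos_cis]) auto

lemma dominates_dpoly:
  assumes P: "finite P" "\<And>p. p \<in> P \<Longrightarrow> prime p" and q: "\<And>p. p \<in> P \<Longrightarrow> 0 \<le> q p \<and> q p < 1"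
    and N: "(\<Prod>P) ^ K \<le> N"
  shows "dominates (resonator 1 P q) (dpoly N j) (\<Prod>p\<in>P. \<Sum>k\<le>K. (q p ^ j / real p) ^ k)"
proof -
  define F where "F t n = of_real (1 / real n) * cis (- (real j * ln (real n)) * t)" for t n
  have Fp: "F t p = of_real (1 / real p) * cis (- ln (real p) * t) ^ j" for t p
  proof -
    have "cis (- ln (real p) * t) ^ j = cis (real j * (- ln (real p) * t))" by (rule Complex.DeMoivre)
    also have "real j * (- ln (real p) * t) = - (real j * ln (real p)) * t" by simp
    finally show ?thesis by (simp only: F_def)
  qed
  have sub: "smooth_nums P K \<subseteq> {1..N}"
    using smooth_nums_subset[OF P(2), of P K] N by auto
  have "dominates (resonator 1 P q) (\<lambda>t. \<Prod>p\<in>P. \<Sum>k\<le>K. F t p ^ k)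
      (\<Prod>p\<in>P. \<Sum>k\<le>K. (1 / real p * q p ^ j) ^ k)"
    unfolding Fp
    by (intro dominates_prod dominates_sum dominates_power dominates_scale dominates_prime)
      (use P q in auto)
  moreover have "(\<Prod>p\<in>P. \<Sum>k\<le>K. F t p ^ k) = (\<Sum>n\<in>smooth_nums P K. F t n)" for t
  proof (rule prod_sum_powers[OF P])
    fix m n :: nat assume "m > 0" "n > 0"
    then show "F t (m * n) = F t m * F t n"
      by (simp add: F_def ln_mult cis_mult algebra_simps)
  qed (auto simp: F_def)
  ultimately have "dominates (resonator 1 P q) (\<lambda>t. \<Sum>n\<in>smooth_nums P K. F t n)
      (\<Prod>p\<in>P. \<Sum>k\<le>K. (q p ^ j / real p) ^ k)" by (simp add: mult.commute)
  then show ?thesis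
  proof (rule dominates_mono)
    have "dpoly N j t - (\<Sum>n\<in>smooth_nums P K. F t n) = (\<Sum>n\<in>{1..N} - smooth_nums P K. F t n)" for t
      unfolding dpoly_def F_def[symmetric] using sub by (subst sum_diff) auto
    then show "trig_pos (\<lambda>t. dpoly N j t - (\<Sum>n\<in>smooth_nums P K. F t n))"
      by (simp only: F_def) (intro trig_pos_sum trig_pos_dpoly_summand)
  qed (use q in \<open>auto intro: trig_pos_resonator\<close>)
qed

lemma trig_pos_minus_1_mult:
  assumes "trig_pos (\<lambda>t. f t - 1)" "trig_pos (\<lambda>t. g t - 1)"
  shows "trig_pos (\<lambda>t. f t * g t - 1)"
proof -
  have "trig_pos g" using trig_pos_add[OF assms(2) trig_pos_1] by simp
  then have "trig_pos (\<lambda>t. (f t - 1) * g t + (g t - 1))" using assms by (intro trig_pos_add trig_pos_mult)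
  then show ?thesis by (simp add: algebra_simps)
qed

text \<open>Each geometric factor has constant term 1. The consequence for |R|^2 is the lower bound
  m^2 for its sum over all pairs (a, b).\<close>

lemma trig_pos_resonator_minus_1:
  assumes "\<And>p. p \<in> P \<Longrightarrow> 0 \<le> q p \<and> q p < 1"
  shows "trig_pos (\<lambda>t. resonator c P q t - 1)"
  unfolding resonator_def using assms
proof (induction P rule: infinite_finite_induct)
  case (insert p P)
  define y where "y t = of_real (q p) * cis (c * ln (real p) * t)" for t
  have y: "norm (y t) < 1" for t
    using insert.prems[of p] by (simp add: y_def norm_mult)
  then have "y t \<noteq> 1" for t by (metis norm_one order_less_irrefl)
  then have "1 / (1 - y t) - 1 = y t * (1 / (1 - y t))" for t
    by (simp add: divide_simps)
  moreover have "trig_pos (\<lambda>t. y t * (1 / (1 - y t)))"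
    unfolding y_def by (intro trig_pos_mult trig_pos_scale trig_pos_cis trig_pos_geometric) (use insert.prems[of p] in auto)
  ultimately have "trig_pos (\<lambda>t. 1 / (1 - y t) - 1)" by simp
  moreover have "trig_pos (\<lambda>t. (\<Prod>p\<in>P. 1 / (1 - of_real (q p) * cis (c * ln (real p) * t))) - 1)"
    using insert by simp
  ultimately show ?case
    unfolding y_def prod.insert[OF insert.hyps] by (rule trig_pos_minus_1_mult)
qed (auto intro: trig_pos_0)

lemma cnj_resonator: "cnj (resonator c P q t) = resonator (- c) P q t"
  by (simp add: resonator_def cis_cnj)

lemma dpoly_minus: "dpoly N j (- t) = cnj (dpoly N j t)"
  by (simp add: dpoly_def cis_cnj)

lemma resonance:
  assumes P: "finite P" "\<And>p. p \<in> P \<Longrightarrow> prime p" and q: "\<And>p. p \<in> P \<Longrightarrow> 0 \<le> q p \<and> q p < 1"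
    and N: "(\<Prod>P) ^ K \<le> N" and m: "m \<ge> 1" and V: "V \<ge> 0"
    and bnd: "\<And>k. 1 \<le> k \<Longrightarrow> k < m \<Longrightarrow> cmod (\<Prod>j=1..l. dpoly N j (h * real k)) \<le> V"
  shows "(\<Prod>j=1..l. \<Prod>p\<in>P. \<Sum>k\<le>K. (q p ^ j / real p) ^ k)
    \<le> V + (\<Sum>n=1..N. 1 / real n) ^ l * (\<Prod>p\<in>P. 1 / (1 - q p))\<^sup>2 / real m"
proof -
  define R where "R = resonator 1 P q"
  define F where "F t = (\<Prod>j=1..l. dpoly N j t)" for t
  define Z where "Z = (\<Prod>j=1..l. \<Prod>p\<in>P. \<Sum>k\<le>K. (q p ^ j / real p) ^ k)"
  define H where "H = (\<Sum>n=1..N. 1 / real n)"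
  define B where "B = (\<Prod>p\<in>P. 1 / (1 - q p))"
  define w where "w t = (cmod (R t))\<^sup>2" for t
  define W where "W = (\<Sum>a<m. \<Sum>b<m. w (h * (real a - real b)))"
  have RR: "R t * resonator (-1) P q t = of_real (w t)" for t
    using complex_norm_square[of "R t"] by (simp add: R_def w_def cnj_resonator)
  have "dominates R F Z"
    unfolding R_def F_def Z_def by (intro dominates_prod dominates_dpoly P q N)
  \<comment> \<open>Multiplying by the conjugate resonator turns R into |R|^2 and preserves
    nonnegative coefficients.\<close>
  then have "trig_pos (\<lambda>t. (F t * R t - of_real Z * R t) * resonator (-1) P q t)"
    by (intro trig_pos_mult trig_pos_resonator q) (simp add: dominates_def)
  then have "trig_pos (\<lambda>t. (F t - of_real Z) * of_real (w t))"
    by (simp add: left_diff_distrib mult.assoc RR)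
  from Re_sum_trig_pos_nonneg[OF this, of h m]
  have 1: "Z * W \<le> (\<Sum>a<m. \<Sum>b<m. Re (F (h * (real a - real b))) * w (h * (real a - real b)))"
    by (simp add: W_def left_diff_distrib sum_subtractf sum_distrib_left)
  have "trig_pos (\<lambda>t. R t * resonator (-1) P q t - 1)"
    unfolding R_def by (intro trig_pos_minus_1_mult trig_pos_resonator_minus_1 q)
  then have "trig_pos (\<lambda>t. of_real (w t) - 1)" by (simp add: RR)
  from Re_sum_trig_pos_nonneg[OF this, of h m]
  have 2: "real m * real m \<le> W" by (simp add: W_def w_def sum_subtractf)
  have F0: "F 0 = of_real (H ^ l)" by (simp add: F_def dpoly_def H_def)
  have w0: "w 0 = B\<^sup>2"
  proof -
    have "R 0 = of_real B" by (simp add: R_def resonator_def B_def)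
    then show ?thesis by (simp add: w_def)
  qed
  have w: "w t \<ge> 0" for t by (simp add: w_def)
  have H0: "H \<ge> 0" by (auto simp: H_def intro: sum_nonneg)
  \<comment> \<open>Off the diagonal the hypothesis on multiples of h applies, after conjugation if
    a < b; on the diagonal F(0) |R(0)|^2 is paid in full.\<close>
  have Fb: "Re (F (h * (real a - real b))) * w (h * (real a - real b))
      \<le> V * w (h * (real a - real b)) + (if a = b then H ^ l * B\<^sup>2 else 0)"
    if "a < m" "b < m" for a b
  proof -
    have sym: "cmod (F (- t)) = cmod (F t)" for t
      by (simp add: F_def dpoly_minus flip: cnj_prod)
    consider "a = b" | "a < b" | "b < a" by linarith
    then show ?thesis
    proof cases
      case 1
      then show ?thesis using V w[of 0] by (simp add: F0 w0)
    next
      case 2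
      have "cmod (F (h * (real a - real b))) = cmod (F (h * real (b - a)))"
        using 2 sym[of "h * real (b - a)"] by (simp add: of_nat_diff algebra_simps)
      also have "\<dots> \<le> V" unfolding F_def using bnd[of "b - a"] 2 that by simp
      finally have "Re (F (h * (real a - real b))) \<le> V"
        using complex_Re_le_cmod[of "F (h * (real a - real b))"] by linarith
      then show ?thesis using 2 w by (simp add: mult_right_mono)
    next
      case 3
      have "cmod (F (h * (real a - real b))) = cmod (F (h * real (a - b)))"
        using 3 by (simp add: of_nat_diff)
      also have "\<dots> \<le> V" unfolding F_def using bnd[of "a - b"] 3 that by simp
      finally have "Re (F (h * (real a - real b))) \<le> V"
        using complex_Re_le_cmod[of "F (h * (real a - real b))"] by linarith
      then show ?thesis using 3 w by (simp add: mult_right_mono)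
    qed
  qed
  note 1
  also have "(\<Sum>a<m. \<Sum>b<m. Re (F (h * (real a - real b))) * w (h * (real a - real b)))
     \<le> (\<Sum>a<m. \<Sum>b<m. V * w (h * (real a - real b)) + (if a = b then H ^ l * B\<^sup>2 else 0))"
    by (intro sum_mono Fb) auto
  also have "\<dots> = V * W + real m * (H ^ l * B\<^sup>2)"
    by (simp add: sum.distrib W_def sum_distrib_left)
  finally have 3: "(Z - V) * W \<le> real m * (H ^ l * B\<^sup>2)" by (simp add: algebra_simps)
  \<comment> \<open>The lower bound W >= m^2 may be inserted only when Z - V is nonnegative;
    otherwise the inequality is trivial.\<close>
  have "Z - V \<le> H ^ l * B\<^sup>2 / real m"
  proof (cases "Z - V \<ge> 0")
    case True
    have "(Z - V) * (real m * real m) \<le> (Z - V) * W" using True 2 by (intro mult_left_mono)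
    with 3 have "real m * ((Z - V) * real m) \<le> real m * (H ^ l * B\<^sup>2)" by (simp add: algebra_simps)
    then have "(Z - V) * real m \<le> H ^ l * B\<^sup>2"
      by (rule mult_left_le_imp_le) (use m in simp)
    then show ?thesis using m by (subst pos_le_divide_eq) auto
  next
    case False
    have "0 \<le> H ^ l * B\<^sup>2 / real m" using H0 by simp
    with False show ?thesis by linarith
  qed
  then show ?thesis by (simp add: Z_def H_def B_def)
qed

subsection \<open>The size of the resonator\<close>

text \<open>At most sqrt n primes lie below sqrt n. Every larger prime has 2 ln p >= ln n, so
  Chebyshev's bound for the sum of ln p counts them.\<close>

lemma card_primes_upto_le:
  assumes "n \<ge> 2"
  shows "real (card (primes_upto n)) \<le> (2 + 2 * ln 4) * real n / ln (real n)"
proof -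
  define L where "L = ln (real n)"
  have L: "L > 0" using assms by (simp add: L_def)
  have Ls: "L \<le> 2 * sqrt (real n)"
    using ln_le_minus_one[of "sqrt (real n)"] assms by (simp add: L_def ln_sqrt)
  have "real (card (primes_upto n)) = (\<Sum>p\<in>primes_upto n. 1)" by simp
  also have "\<dots> \<le> (\<Sum>p\<in>primes_upto n. (if real p \<le> sqrt (real n) then 1 else 0) + 2 * ln (real p) / L)"
  proof (rule sum_mono)
    fix p assume p: "p \<in> primes_upto n"
    have p2: "p \<ge> 2" using primes_uptoD(3)[OF p] .
    show "1 \<le> (if real p \<le> sqrt (real n) then 1 else 0) + 2 * ln (real p) / L"
    proof (cases "real p \<le> sqrt (real n)")
      case False
      then have "ln (sqrt (real n)) \<le> ln (real p)"
        using assms p2 by (subst ln_le_cancel_iff) auto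
      then have "L \<le> 2 * ln (real p)" using assms by (simp add: L_def ln_sqrt)
      then show ?thesis using L False by simp
    qed (use p2 L in simp)
  qed
  also have "\<dots> = (\<Sum>p\<in>primes_upto n. if real p \<le> sqrt (real n) then 1 else 0)
      + 2 / L * (\<Sum>p\<in>primes_upto n. ln (real p))"
    by (simp add: sum.distrib sum_distrib_left)
  also have "\<dots> \<le> sqrt (real n) + 2 / L * (ln 4 * real n)"
  proof (intro add_mono mult_left_mono sum_ln_primes_upto_le)
    have "(\<Sum>p\<in>primes_upto n. if real p \<le> sqrt (real n) then 1 else 0 :: real)
        = real (card (primes_upto n \<inter> {p. real p \<le> sqrt (real n)}))"
      by (simp add: sum.If_cases)
    also have "\<dots> \<le> real (card {1..nat \<lfloor>sqrt (real n)\<rfloor>})"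
    proof (intro of_nat_mono card_mono subsetI)
      fix p assume "p \<in> primes_upto n \<inter> {p. real p \<le> sqrt (real n)}"
      then show "p \<in> {1..nat \<lfloor>sqrt (real n)\<rfloor>}"
        using le_nat_floor[of p "sqrt (real n)"] primes_uptoD(3)[of p n] by simp
    qed auto
    also have "\<dots> \<le> sqrt (real n)" by simp
    finally show "(\<Sum>p\<in>primes_upto n. if real p \<le> sqrt (real n) then 1 else 0) \<le> sqrt (real n)" .
  qed (use L in auto)
  also have "sqrt (real n) \<le> 2 * real n / L"
  proof -
    have "sqrt (real n) * L \<le> sqrt (real n) * (2 * sqrt (real n))"
      using Ls by (intro mult_left_mono) auto
    also have "\<dots> = 2 * real n" by simp
    finally show ?thesis using L by (simp add: pos_le_divide_eq)
  qed
  also have "2 * real n / L + 2 / L * (ln 4 * real n) = (2 + 2 * ln 4) * real n / L"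
    by (simp add: algebra_simps add_divide_distrib)
  finally show ?thesis by (simp add: L_def)
qed

text \<open>A discrete derivative of x / ln x; it lets the next estimate be proved by induction in
  place of an integral.\<close>

lemma div_ln_increment_ge:
  assumes x: "x > 0" "ln x \<ge> (2::real)"
  shows "1 / (4 * ln x) \<le> (x + 1) / ln (x + 1) - x / ln x"
proof -
  define L where "L = ln x"
  have L: "L \<ge> 2" using x by (simp add: L_def)
  have x1: "x > 1"
    using x ln_le_zero_iff[of x] by linarith
  have "ln (x + 1) - ln x \<le> 1 / x"
    using ln_diff_le[of "x + 1" x] x1 by simp
  then have "ln (x + 1) \<le> L + 1 / x" by (simp add: L_def)
  moreover have "ln (x + 1) > 0" using x1 by simp
  ultimately have 1: "(x + 1) / (L + 1 / x) \<le> (x + 1) / ln (x + 1)"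
    using x1 L by (intro divide_left_mono mult_pos_pos) (auto intro: add_pos_pos)
  have inv: "0 < 1 / x" "1 / x < 1" using x1 by auto
  have "(x + 1) / (L + 1 / x) - x / L = (L - 1) / (L * (L + 1 / x))"
  proof (subst diff_frac_eq)
    show "L + 1 / x \<noteq> 0" using L inv by linarith
    have "(x + 1) * L - x * (L + 1 / x) = L - 1" using x1 by (simp add: algebra_simps)
    then show "((x + 1) * L - x * (L + 1 / x)) / ((L + 1 / x) * L) = (L - 1) / (L * (L + 1 / x))"
      by (simp only: mult.commute)
  qed (use L in simp)
  moreover have "1 / (4 * L) \<le> (L - 1) / (L * (L + 1 / x))"
  proof -
    have "1 / (4 * (L - 1)) \<le> 1 / (L + r)" if "r < 1" "0 < r" for r :: real
      using L that by (intro divide_left_mono mult_pos_pos) auto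
    then have "1 / (4 * (L - 1)) \<le> 1 / (L + 1 / x)" using inv by blast
    then have "(L - 1) / L * (1 / (4 * (L - 1))) \<le> (L - 1) / L * (1 / (L + 1 / x))"
      using L by (intro mult_left_mono) auto
    moreover have "(L - 1) / L * (1 / (4 * (L - 1))) = 1 / (4 * L)"
      using L by (simp add: field_simps)
    ultimately show ?thesis by simp
  qed
  ultimately show ?thesis using 1 by (simp add: L_def)
qed

text \<open>Raising x by 1 adds ln ((x+1)/x) <= 1/x for each prime up to x, in total O(1 / ln x) by
  Chebyshev. This is matched by the growth of x / ln x.\<close>

lemma sum_ln_ratio_primes_le:
  obtains C where "C > 0"
    "\<And>x. x \<ge> 8 \<Longrightarrow> (\<Sum>p\<in>primes_upto x. ln (real x / real p)) \<le> C * real x / ln (real x)"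
proof -
  define G where "G x = (\<Sum>p\<in>primes_upto x. ln (real x / real p))" for x :: nat
  define c where "c = 2 + 2 * ln (4::real)"
  have c: "c > 0" by (simp add: c_def add_pos_pos)
  have Gpos: "G x \<ge> 0" for x
    unfolding G_def by (intro sum_nonneg) (auto simp: primes_upto_def intro!: ln_ge_zero dest: prime_gt_0_nat)
  have main: "G x \<le> G 8 + 4 * c * (real x / ln (real x))" if "8 \<le> x" for x
    using that
  proof (induction x rule: dec_induct)
    case base
    have "0 \<le> 4 * c * (real 8 / ln (real 8))" using c by (intro mult_nonneg_nonneg) auto
    then show ?case by simp
  next
    case (step x)
    have x: "real x \<ge> 8" using step by simp
    \<comment> \<open>This explains the starting point 8 = 2^3.\<close>
    have ln8: "ln (real x) \<ge> 2"
    proof -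
      have "2 \<le> 3 * ln (2::real)" using ln2_ge_two_thirds by simp
      also have "\<dots> = ln (2 ^ 3)" by (subst ln_realpow) auto
      also have "\<dots> \<le> ln (real x)" using x by (subst ln_le_cancel_iff) auto
      finally show ?thesis .
    qed
    \<comment> \<open>If x + 1 is prime, its own new term is ln 1 = 0.\<close>
    have "G (Suc x) = (\<Sum>p\<in>primes_upto x. ln (real (Suc x) / real p))"
      by (simp add: G_def sum_primes_upto_Suc)
    also have "\<dots> = (\<Sum>p\<in>primes_upto x. ln (real x / real p) + (ln (real (Suc x)) - ln (real x)))"
      using x by (intro sum.cong refl) (auto simp: ln_div dest!: primes_uptoD)
    also have "\<dots> = G x + real (card (primes_upto x)) * (ln (real (Suc x)) - ln (real x))"
      by (simp add: sum.distrib G_def)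
    also have "\<dots> \<le> G x + (c * real x / ln (real x)) * (1 / real x)"
    proof (intro add_left_mono mult_mono)
      show "ln (real (Suc x)) - ln (real x) \<le> 1 / real x"
        using ln_diff_le[of "real (Suc x)" "real x"] x by simp
    qed (use x c card_primes_upto_le[of x] in \<open>auto simp: c_def\<close>)
    also have "\<dots> = G x + 4 * c * (1 / (4 * ln (real x)))" using x by simp
    also have "\<dots> \<le> G x + 4 * c * ((real x + 1) / ln (real x + 1) - real x / ln (real x))"
      using x ln8 c by (intro add_left_mono mult_left_mono div_ln_increment_ge) auto
    also have "\<dots> \<le> G 8 + 4 * c * (real (Suc x) / ln (real (Suc x)))"
      using step.IH by (simp add: algebra_simps)
    finally show ?case .
  qed
  show thesis
  proof (rule that[of "G 8 + 4 * c"])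
    show "G 8 + 4 * c > 0" using c Gpos[of 8] by simp
    fix x :: nat assume x: "x \<ge> 8"
    have "ln (real x) \<le> real x" "ln (real x) > 0" using ln_le_minus_one[of "real x"] x by auto
    then have "1 \<le> real x / ln (real x)" by simp
    then have "G 8 * 1 \<le> G 8 * (real x / ln (real x))" using Gpos by (intro mult_left_mono) auto
    then show "(\<Sum>p\<in>primes_upto x. ln (real x / real p)) \<le> (G 8 + 4 * c) * real x / ln (real x)"
      using main[OF x] by (simp add: G_def[symmetric] algebra_simps add_divide_distrib)
  qed
qed

text \<open>With q_p = 1 - p/x the ratio x/p equals 1/(1 - q_p), so this product is the value of the
  resonator at 0.\<close>

lemma prod_ratio_primes_le:
  obtains C where "C > 0"
    "\<And>x. x \<ge> 8 \<Longrightarrow> (\<Prod>p\<in>primes_upto x. real x / real p) \<le> exp (C * real x / ln (real x))"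
proof -
  obtain C where C: "C > 0"
    "\<And>x. x \<ge> 8 \<Longrightarrow> (\<Sum>p\<in>primes_upto x. ln (real x / real p)) \<le> C * real x / ln (real x)"
    using sum_ln_ratio_primes_le by metis
  show thesis
  proof (rule that[OF C(1)])
    fix x :: nat assume x: "x \<ge> 8"
    have "(\<Prod>p\<in>primes_upto x. real x / real p) = (\<Prod>p\<in>primes_upto x. exp (ln (real x / real p)))"
      using x by (intro prod.cong) (auto dest!: primes_uptoD)
    also have "\<dots> = exp (\<Sum>p\<in>primes_upto x. ln (real x / real p))" by (simp add: exp_sum)
    finally show "(\<Prod>p\<in>primes_upto x. real x / real p) \<le> exp (C * real x / ln (real x))"
      using C(2)[OF x] by simp
  qed
qed

subsection \<open>The resonating Euler product\<close>

text \<open>Two losses occur. Replacing 1/p by q^j / p costs a factor 1 - 2j/x, by Bernoulli's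
  inequality; cutting the geometric series after k = x costs 1 - 1/x, since its ratio is at most
  1/2.\<close>

lemma euler_factor_ge:
  assumes p: "2 \<le> p" "p \<le> x" and j: "2 * j + 1 \<le> (x::nat)"
  shows "(1 - (2 * real j + 1) / real x) * (1 / (1 - 1 / real p))
    \<le> (\<Sum>k\<le>x. ((1 - real p / real x) ^ j / real p) ^ k)"
proof -
  define q where "q = 1 - real p / real x"
  define y where "y = q ^ j / real p"
  define u where "u = 1 - 1 / real p"
  define v where "v = real j / real x"
  have x: "real x \<ge> 2" using p by simp
  have q: "0 \<le> q" "q \<le> 1" using p by (auto simp: q_def)
  have y: "0 \<le> y" "y \<le> 1 / 2"
  proof -
    have "y \<le> 1 / real p" unfolding y_def using q p by (intro divide_right_mono power_le_one) auto
    also have "\<dots> \<le> 1 / 2" using p by (intro divide_left_mono) auto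
    finally show "y \<le> 1 / 2" .
  qed (use q in \<open>simp add: y_def\<close>)
  have u: "u \<ge> 1 / 2" "u > 0"
  proof -
    have "1 / real p \<le> 1 / 2" using p by (intro divide_left_mono) auto
    then show "u \<ge> 1 / 2" "u > 0" by (auto simp: u_def)
  qed
  have "real (2 * j + 1) \<le> real x" using j by (simp only: of_nat_le_iff)
  then have v: "0 \<le> v" "1 - 2 * v \<ge> 0" using x by (auto simp: v_def field_simps)
  have "1 - real j * (real p / real x) \<le> q ^ j"
    using Bernoulli_inequality[of "- (real p / real x)" j] q by (simp add: q_def)
  then have "(1 - q ^ j) / real p \<le> (real j * (real p / real x)) / real p"
    by (intro divide_right_mono) auto
  also have "\<dots> = v" using p by (simp add: v_def)
  finally have "1 - y \<le> u + v" by (simp add: u_def y_def diff_divide_distrib)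
  then have "(1 - 2 * v) * (1 - y) \<le> (1 - 2 * v) * (u + v)" using v by (intro mult_left_mono)
  \<comment> \<open>Both corrections have the right sign because u = 1 - 1/p >= 1/2; hence the
    factor 2 in 1 - 2v.\<close>
  also have "\<dots> = u - (2 * u - 1) * v - 2 * v\<^sup>2" by (simp add: algebra_simps power2_eq_square)
  also have "\<dots> \<le> u"
  proof -
    have "0 \<le> (2 * u - 1) * v" using u v by (intro mult_nonneg_nonneg) auto
    then show ?thesis by (smt (verit) zero_le_power2)
  qed
  finally have 1: "(1 - 2 * v) / u \<le> 1 / (1 - y)" using u y by (simp add: field_simps)
  have "(1/2::real) ^ x \<le> 1 / real x"
  proof -
    have "real x < 2 ^ x" by (rule of_nat_less_two_power)
    then show ?thesis using x by (simp add: power_one_over field_simps)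
  qed
  then have "y ^ Suc x \<le> 1 / real x"
    using y power_mono[of y "1/2" "Suc x"] power_decreasing[of x "Suc x" "1/2::real"] by linarith
  then have "1 - 1 / real x \<le> 1 - y ^ Suc x" by simp
  moreover have "y ^ Suc x \<le> 1" using y by (intro power_le_one) auto
  ultimately have "(1 - 1 / real x) * ((1 - 2 * v) / u) \<le> (1 - y ^ Suc x) * (1 / (1 - y))"
    using 1 v u x y by (intro mult_mono) (auto simp del: power_Suc)
  also have "\<dots> = (\<Sum>k\<le>x. y ^ k)"
    using y by (simp add: sum_gp0)
  finally have 2: "(1 - 1 / real x) * (1 - 2 * v) * (1 / u) \<le> (\<Sum>k\<le>x. y ^ k)" by simp
  have "1 - (2 * real j + 1) / real x \<le> (1 - 1 / real x) * (1 - 2 * v)"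
  proof -
    have "0 \<le> 1 / real x * (2 * v)" using v by simp
    moreover have "(1 - a) * (1 - b) = 1 - a - b + a * b" for a b :: real
      by (simp add: algebra_simps)
    moreover have "(2 * real j + 1) / real x = 2 * v + 1 / real x"
      by (simp add: v_def add_divide_distrib)
    ultimately show ?thesis by simp
  qed
  then have "(1 - (2 * real j + 1) / real x) * (1 / u) \<le> (1 - 1 / real x) * (1 - 2 * v) * (1 / u)"
    using u by (intro mult_right_mono) auto
  with 2 show ?thesis by (simp add: y_def q_def u_def)
qed

lemma exp_mertens_sum: "exp (mertens_sum x) = (\<Prod>p\<in>primes_upto x. 1 / (1 - 1 / real p))"
  unfolding mertens_sum_def by (subst exp_sum) (auto intro!: prod.cong simp: exp_minus inverse_eq_divide dest!: primes_uptoD)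

text \<open>The relative loss 1 - (2l+1)/x per prime accumulates, by Bernoulli and Chebyshev, to at
  most c / ln x. Multiplied by Mertens' e^gamma ln x, this shifts ln x by a constant only.\<close>

lemma resonating_product_ge:
  obtains C where "C > 0" "\<And>j x. j \<le> l \<Longrightarrow> 2 * l + 1 \<le> x \<Longrightarrow> 2 \<le> x \<Longrightarrow>
     exp euler_mascheroni * (ln (real x) - C)
       \<le> (\<Prod>p\<in>primes_upto x. \<Sum>k\<le>x. ((1 - real p / real x) ^ j / real p) ^ k)"
proof -
  obtain C1 where C1: "C1 > 0" "\<And>n. 2 \<le> n \<Longrightarrow>
     mertens_sum n \<ge> ln (ln (real n)) + euler_mascheroni - C1 / ln (real n)"
    using mertens_sum_ge by metis
  define c where "c = (2 * real l + 1) * (2 + 2 * ln (4::real))"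
  have c: "c > 0" unfolding c_def by (intro mult_pos_pos) (auto intro: add_nonneg_pos)
  show thesis
  proof (rule that[of "C1 + c"])
    fix j x :: nat assume jx: "j \<le> l" "2 * l + 1 \<le> x" "2 \<le> x"
    define L where "L = ln (real x)"
    define Y where "Y = (\<Prod>p\<in>primes_upto x. \<Sum>k\<le>x. ((1 - real p / real x) ^ j / real p) ^ k)"
    have L: "L > 0" using jx by (simp add: L_def)
    have Y0: "0 \<le> Y" unfolding Y_def
      by (intro prod_nonneg sum_nonneg ballI zero_le_power divide_nonneg_nonneg)
        (auto simp: primes_upto_def dest: prime_gt_0_nat)
    show "exp euler_mascheroni * (ln (real x) - (C1 + c)) \<le> Y"
    \<comment> \<open>For small x the left side is not positive, so the constant C makes the claim
      trivial there.\<close>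
    proof (cases "L \<ge> C1 + c")
      case False
      then have "exp euler_mascheroni * (ln (real x) - (C1 + c)) \<le> 0"
        by (intro mult_nonneg_nonpos) (auto simp: L_def)
      with Y0 show ?thesis by linarith
    next
      case True
      define a where "a = (2 * real l + 1) / real x"
      have "real (2 * l + 1) \<le> real x" using jx by (simp only: of_nat_le_iff)
      then have a: "0 \<le> a" "a \<le> 1" using jx by (auto simp: a_def)
      have "1 - c / L \<le> 1 - real (card (primes_upto x)) * a"
      proof -
        have "real (card (primes_upto x)) * a \<le> ((2 + 2 * ln 4) * real x / ln (real x)) * a"
          using a jx by (intro mult_right_mono card_primes_upto_le) auto
        also have "\<dots> = c / L" using jx by (simp add: a_def c_def L_def)
        finally show ?thesis by simp
      qed
      also have "\<dots> \<le> (1 - a) ^ card (primes_upto x)"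
        using Bernoulli_inequality[of "- a" "card (primes_upto x)"] a by simp
      finally have 1: "1 - c / L \<le> (1 - a) ^ card (primes_upto x)" .
      have "exp euler_mascheroni * (L - C1) \<le> exp euler_mascheroni * (L * exp (- C1 / L))"
      proof (intro mult_left_mono)
        have "L * (1 + (- C1 / L)) \<le> L * exp (- C1 / L)"
          using L by (intro mult_left_mono exp_ge_add_one_self) auto
        then show "L - C1 \<le> L * exp (- C1 / L)" using L by (simp add: algebra_simps)
      qed auto
      also have "\<dots> = exp (ln L + euler_mascheroni - C1 / L)"
        using L by (simp add: exp_add exp_diff exp_minus divide_inverse)
      also have "\<dots> \<le> exp (mertens_sum x)" using C1(2)[OF jx(3)] by (simp add: L_def)
      finally have 2: "exp euler_mascheroni * (L - C1) \<le> exp (mertens_sum x)" .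
      have "exp euler_mascheroni * (L - (C1 + c)) \<le> (1 - c / L) * (exp euler_mascheroni * (L - C1))"
      proof -
        have "0 \<le> c * C1 / L" using c C1 L by simp
        then have "L - (C1 + c) \<le> (1 - c / L) * (L - C1)" using L by (simp add: field_simps)
        then show ?thesis by (simp add: mult_left_mono mult.left_commute)
      qed
      also have "\<dots> \<le> (1 - a) ^ card (primes_upto x) * exp (mertens_sum x)"
        using 1 2 True c L a C1 by (intro mult_mono) auto
      also have "\<dots> = (\<Prod>p\<in>primes_upto x. (1 - a) * (1 / (1 - 1 / real p)))"
        by (simp add: exp_mertens_sum prod.distrib prod_dividef)
      also have "\<dots> \<le> Y" unfolding Y_def
      proof (intro prod_mono conjI)
        fix p assume p: "p \<in> primes_upto x"
        note p' = primes_uptoD[OF p]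
        show "0 \<le> (1 - a) * (1 / (1 - 1 / real p))" using a p' by simp
        have "1 - a \<le> 1 - (2 * real j + 1) / real x"
          unfolding a_def using jx by (auto intro!: divide_right_mono)
        then have "(1 - a) * (1 / (1 - 1 / real p)) \<le> (1 - (2 * real j + 1) / real x) * (1 / (1 - 1 / real p))"
          using p' by (intro mult_right_mono) auto
        also have "\<dots> \<le> (\<Sum>k\<le>x. ((1 - real p / real x) ^ j / real p) ^ k)"
          using p' jx by (intro euler_factor_ge) auto
        finally show "(1 - a) * (1 / (1 - 1 / real p)) \<le> (\<Sum>k\<le>x. ((1 - real p / real x) ^ j / real p) ^ k)" .
      qed
      finally show ?thesis by (simp add: L_def)
    qed
  qed (use C1 c in simp)
qed

subsection \<open>Approximating \<open>\<zeta>(1 + it)\<close> by a Dirichlet polynomial\<close>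

definition zeta_approx :: "complex \<Rightarrow> nat \<Rightarrow> complex" where
  "zeta_approx s N = (\<Sum>n=1..N. 1 / (of_nat n) powr s) - (of_nat N) powr (1 - s) / (1 - s)"

lemma closed_segment_of_nat_Suc:
  "closed_segment (complex_of_nat n) (of_nat (Suc n)) = of_real ` {real n..real (Suc n)}"
proof -
  have "closed_segment (of_real (real n)) (of_real (real (Suc n)) :: complex)
      = of_real ` closed_segment (real n) (real (Suc n))"
    by (rule closed_segment_of_real)
  then show ?thesis by (simp add: closed_segment_eq_real_ivl)
qed

lemma powr_diff_le:
  assumes s: "Re s = 1" and n: "n \<ge> (1::nat)" and u: "u \<in> {real n..real (Suc n)}"
  shows "norm (of_real u powr (- s) - of_nat (Suc n) powr (- s)) \<le> norm s / (real n)\<^sup>2"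
proof -
  define S where "S = closed_segment (complex_of_nat n) (of_nat (Suc n))"
  have S: "S = of_real ` {real n..real (Suc n)}"
    unfolding S_def by (rule closed_segment_of_nat_Suc)
  have uS: "of_real u \<in> S" using u unfolding S by (rule imageI)
  have "norm (of_real u powr (- s) - of_nat (Suc n) powr (- s))
      \<le> (norm s / (real n)\<^sup>2) * norm (of_real u - complex_of_nat (Suc n))"
  proof (rule field_differentiable_bound[where S = S and f' = "\<lambda>z. - s * z powr (- s - 1)"])
    show "convex S" by (simp add: S_def)
    fix z assume "z \<in> S"
    then obtain v where v: "v \<in> {real n..real (Suc n)}" "z = of_real v" unfolding S by blast
    have v0: "v > 0" using v n by auto
    have "z \<notin> \<real>\<^sub>\<le>\<^sub>0" using v v0 by (simp add: complex_nonpos_Reals_iff)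
    then show "((\<lambda>z. z powr (- s)) has_field_derivative - s * z powr (- s - 1)) (at z within S)"
      by (rule has_field_derivative_at_within[OF has_field_derivative_powr])
    have "norm (z powr (- s - 1)) = v powr (- 2)"
      using v v0 s by (simp add: norm_powr_real_powr)
    also have "\<dots> \<le> real n powr (- 2)" using v n by (intro powr_mono2') auto
    also have "\<dots> = 1 / (real n)\<^sup>2" using n by (simp add: powr_minus inverse_eq_divide)
    finally show "norm (- s * z powr (- s - 1)) \<le> norm s / (real n)\<^sup>2"
      using mult_left_mono[of "norm (z powr (- s - 1))" "1 / (real n)\<^sup>2" "norm s"] by (simp add: norm_mult)
  qed (use uS in \<open>simp_all add: S_def\<close>)
  also have "\<dots> \<le> (norm s / (real n)\<^sup>2) * 1"
  proof (intro mult_left_mono)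
    have "norm (of_real u - complex_of_nat (Suc n)) = \<bar>u - real (Suc n)\<bar>"
      by (metis norm_of_real of_real_diff of_real_of_nat_eq)
    then show "norm (of_real u - complex_of_nat (Suc n)) \<le> 1" using u by auto
  qed auto
  finally show ?thesis by simp
qed

text \<open>The increment is (n+1)^(-s) minus the integral of u^(-s) over [n, n+1]. The mean value
  inequality for an antiderivative of u^(-s) - (n+1)^(-s) takes the place of the integral.\<close>

lemma zeta_approx_step:
  assumes s: "Re s = 1" "s \<noteq> 1" and n: "n \<ge> (1::nat)"
  shows "norm (zeta_approx s (Suc n) - zeta_approx s n) \<le> norm s / (real n)\<^sup>2"
proof -
  define S where "S = closed_segment (complex_of_nat n) (of_nat (Suc n))"
  have S: "S = of_real ` {real n..real (Suc n)}"
    unfolding S_def by (rule closed_segment_of_nat_Suc)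
  define w where "w = complex_of_nat (Suc n) powr (- s)"
  \<comment> \<open>This antiderivative is arranged so that g(n) - g(n+1) is exactly the
    increment.\<close>
  define g where "g z = z powr (1 - s) / (1 - s) - z * w" for z
  have "norm (g (of_nat n) - g (of_nat (Suc n))) \<le> (norm s / (real n)\<^sup>2) * norm (of_nat n - complex_of_nat (Suc n))"
  proof (rule field_differentiable_bound[where S = S and f' = "\<lambda>z. z powr (- s) - w"])
    show "convex S" by (simp add: S_def)
    fix z assume "z \<in> S"
    then obtain v where v: "v \<in> {real n..real (Suc n)}" "z = of_real v" unfolding S by blast
    have v0: "v > 0" using v n by auto
    have z: "z \<notin> \<real>\<^sub>\<le>\<^sub>0" using v v0 by (simp add: complex_nonpos_Reals_iff)
    have "(g has_field_derivative ((1 - s) * z powr (1 - s - 1) / (1 - s) - 1 * w)) (at z)"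
      unfolding g_def
      by (intro DERIV_diff DERIV_cdivide DERIV_cmult_right DERIV_ident has_field_derivative_powr z)
    then show "(g has_field_derivative z powr (- s) - w) (at z within S)"
      using s by (auto dest: has_field_derivative_at_within)
    show "norm (z powr (- s) - w) \<le> norm s / (real n)\<^sup>2"
      using powr_diff_le[OF s(1) n v(1)] v by (simp add: w_def)
  qed (auto simp: S_def)
  moreover have "zeta_approx s (Suc n) - zeta_approx s n = g (of_nat n) - g (of_nat (Suc n))"
    by (simp add: zeta_approx_def g_def w_def powr_minus divide_inverse algebra_simps)
  ultimately show ?thesis by simp
qed

text \<open>The step bound is summed through 1/n^2 <= 2 (1/n - 1/(n+1)), which telescopes.\<close>

lemma zeta_approx_diff:
  assumes s: "Re s = 1" "s \<noteq> 1" and N: "1 \<le> N" "N \<le> M"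
  shows "norm (zeta_approx s M - zeta_approx s N) \<le> 2 * norm s * (1 / real N - 1 / real M)"
  using N(2)
proof (induction M rule: dec_induct)
  case (step n)
  have n: "real n \<ge> 1" using step N by simp
  have "norm (zeta_approx s (Suc n) - zeta_approx s N)
      \<le> norm (zeta_approx s (Suc n) - zeta_approx s n) + norm (zeta_approx s n - zeta_approx s N)"
    by (rule norm_diff_triangle_ineq[of "zeta_approx s (Suc n)" "zeta_approx s n"
        "zeta_approx s n" "zeta_approx s N", simplified, THEN order_trans]) simp
  also have "\<dots> \<le> norm s / (real n)\<^sup>2 + 2 * norm s * (1 / real N - 1 / real n)"
    using step N by (intro add_mono zeta_approx_step s) auto
  also have "norm s / (real n)\<^sup>2 \<le> 2 * norm s * (1 / real n - 1 / real (Suc n))"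
  proof -
    have "1 / (real n)\<^sup>2 \<le> 2 * (1 / real n - 1 / real (Suc n))"
    proof -
      have "1 / (real n)\<^sup>2 = 2 / (real n * (real n + real n))" using n by (simp add: power2_eq_square)
      also have "\<dots> \<le> 2 / (real n * real (Suc n))"
        using n by (intro divide_left_mono mult_left_mono mult_pos_pos) auto
      also have "\<dots> = 2 * (1 / real n - 1 / real (Suc n))" using n by (simp add: field_simps)
      finally show ?thesis .
    qed
    from mult_left_mono[OF this, of "norm s"] show ?thesis by (simp add: algebra_simps)
  qed
  finally show ?case by (simp add: algebra_simps)
qed simp

lemma zeta_approx_LIMSEQ:
  assumes s: "Re s = 1" "s \<noteq> 1"
  shows "zeta_approx s \<longlonglongrightarrow> zeta s"
proof -
  have "Cauchy (zeta_approx s)"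
  proof (rule CauchyI')
    fix e :: real assume e: "e > 0"
    obtain N where N: "real N > 2 * norm s / e" using reals_Archimedean2 by blast
    show "\<exists>M. \<forall>m\<ge>M. \<forall>n>m. dist (zeta_approx s m) (zeta_approx s n) < e"
    proof (intro exI[of _ "Suc N"] allI impI)
      fix m n assume mn: "m \<ge> Suc N" "n > m"
      have "norm (zeta_approx s m - zeta_approx s n) = norm (zeta_approx s n - zeta_approx s m)"
        by (rule norm_minus_commute)
      also have "\<dots> \<le> 2 * norm s * (1 / real m - 1 / real n)"
        using mn by (intro zeta_approx_diff s) auto
      also have "\<dots> \<le> 2 * norm s * (1 / real m)" by (intro mult_left_mono) auto
      also have "\<dots> < e"
      proof -
        have "2 * norm s / e < real m" using N mn by linarith
        then show ?thesis using e mn by (simp add: field_simps)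
      qed
      finally show "dist (zeta_approx s m) (zeta_approx s n) < e" by (simp add: dist_norm)
    qed
  qed
  then have "convergent (zeta_approx s)" by (rule Cauchy_convergent)
  then show ?thesis
    unfolding zeta_def zeta_approx_def[symmetric] by (simp add: convergent_LIMSEQ_iff)
qed

text \<open>The term 1/t is the modulus of N^(1-s)/(1-s) on Re s = 1, independent of N; the other
  term is the tail of the approximating sequence.\<close>

lemma norm_zeta_minus_sum_le:
  assumes s: "s = Complex 1 t" "t > 0" and N: "N \<ge> 1"
  shows "norm (zeta s - (\<Sum>n=1..N. 1 / (of_nat n) powr s)) \<le> 1 / t + 2 * (1 + t) / real N"
proof -
  have s1: "Re s = 1" "s \<noteq> 1" using s by (auto simp: complex_eq_iff)
  have ns: "norm s \<le> 1 + t" using cmod_le[of s] s by simp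
  have "norm (zeta s - zeta_approx s N) \<le> 2 * norm s / real N"
  proof (rule tendsto_upperbound)
    show "(\<lambda>M. norm (zeta_approx s M - zeta_approx s N)) \<longlonglongrightarrow> norm (zeta s - zeta_approx s N)"
      by (intro tendsto_intros zeta_approx_LIMSEQ s1)
    show "\<forall>\<^sub>F M in sequentially. norm (zeta_approx s M - zeta_approx s N) \<le> 2 * norm s / real N"
    proof (rule eventually_sequentiallyI[of N])
      fix M assume "M \<ge> N"
      then have "norm (zeta_approx s M - zeta_approx s N) \<le> 2 * norm s * (1 / real N - 1 / real M)"
        using N by (intro zeta_approx_diff s1)
      also have "\<dots> \<le> 2 * norm s * (1 / real N)" by (intro mult_left_mono) auto
      finally show "norm (zeta_approx s M - zeta_approx s N) \<le> 2 * norm s / real N" by simp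
    qed
  qed auto
  also have "\<dots> \<le> 2 * (1 + t) / real N" using ns by (intro divide_right_mono) auto
  finally have 1: "norm (zeta s - zeta_approx s N) \<le> 2 * (1 + t) / real N" .
  have "norm ((of_nat N :: complex) powr (1 - s) / (1 - s)) = 1 / t"
  proof -
    have "norm ((of_nat N :: complex) powr (1 - s)) = real N powr 0"
      using N s by (subst norm_powr_real_powr) auto
    moreover have "1 - s = - (\<i> * of_real t)" using s by (simp add: complex_eq_iff)
    then have "norm (1 - s) = t" using s by (simp add: norm_mult)
    ultimately show ?thesis using N by (simp add: norm_divide)
  qed
  moreover have "zeta s - (\<Sum>n=1..N. 1 / (of_nat n) powr s)
      = (zeta s - zeta_approx s N) - (of_nat N) powr (1 - s) / (1 - s)"
    by (simp add: zeta_approx_def)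
  ultimately have "norm (zeta s - (\<Sum>n=1..N. 1 / (of_nat n) powr s)) \<le> norm (zeta s - zeta_approx s N) + 1 / t"
    using norm_triangle_ineq4[of "zeta s - zeta_approx s N" "(of_nat N) powr (1 - s) / (1 - s)"]
    by (simp only:)
  with 1 show ?thesis by linarith
qed

lemma dpoly_eq_sum_powr:
  "dpoly N j t = (\<Sum>n=1..N. 1 / (of_nat n) powr (1 + \<i> * of_real (real j * t)))"
  unfolding dpoly_def
proof (rule sum.cong[OF refl])
  fix n assume n: "n \<in> {1..N}"
  define a where "a = real j * t * ln (real n)"
  have "(of_nat n :: complex) powr (1 + \<i> * of_real (real j * t)) = exp ((1 + \<i> * of_real (real j * t)) * of_real (ln (real n)))"
    using n by (simp only: powr_def Ln_of_nat) simp
  also have "\<dots> = exp (of_real (ln (real n))) * exp (\<i> * of_real a)"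
    by (simp add: a_def exp_add[symmetric] algebra_simps)
  also have "\<dots> = of_nat n * cis a"
    using n by (simp add: exp_of_real cis_conv_exp)
  finally have "1 / (of_nat n) powr (1 + \<i> * of_real (real j * t)) = 1 / of_nat n * (1 / cis a)"
    by (simp only: times_divide_times_eq mult_1)
  also have "1 / cis a = cis (- a)" by (simp add: divide_inverse cis_inverse)
  also have "- a = - (real j * ln (real n)) * t" by (simp add: a_def)
  finally show "of_real (1 / real n) * cis (- (real j * ln (real n)) * t)
      = 1 / (of_nat n) powr (1 + \<i> * of_real (real j * t))" by (simp only: of_real_divide of_real_1 of_real_of_nat_eq)
qed

lemma norm_zeta_minus_dpoly_le:
  assumes "j \<ge> 1" "t > 0" "N \<ge> 1"
  shows "norm (zeta (1 + \<i> * of_real (real j * t)) - dpoly N j t)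
    \<le> 1 / t + 2 * (1 + real j * t) / real N"
proof -
  have "1 / (real j * t) \<le> 1 / t"
    using assms by (intro divide_left_mono) (auto simp: mult_le_cancel_right1)
  then show ?thesis
    using norm_zeta_minus_sum_le[of "1 + \<i> * of_real (real j * t)" "real j * t" N] assms
    by (simp add: dpoly_eq_sum_powr complex_eq_iff)
qed

lemma norm_dpoly_le: "norm (dpoly N j t) \<le> (\<Sum>n=1..N. 1 / real n)"
  unfolding dpoly_def by (rule norm_sum[THEN order_trans]) (simp add: norm_mult norm_divide)

text \<open>The factors are exchanged one at a time; each exchange costs e times at most B^l, where
  B >= 1 allows rounding the exponent up.\<close>

lemma norm_prod_diff_le:
  fixes a b :: "nat \<Rightarrow> complex"
  assumes "\<And>j. j \<in> {1..l} \<Longrightarrow> norm (a j) \<le> B" "\<And>j. j \<in> {1..l} \<Longrightarrow> norm (b j) \<le> B"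
    "\<And>j. j \<in> {1..l} \<Longrightarrow> norm (a j - b j) \<le> e" and B: "B \<ge> 1"
  shows "norm ((\<Prod>j=1..l. a j) - (\<Prod>j=1..l. b j)) \<le> real l * e * B ^ l"
  using assms(1-3)
proof (induction l)
  case (Suc l)
  define A where "A = (\<Prod>j=1..l. a j)"
  define A' where "A' = (\<Prod>j=1..l. b j)"
  have "norm (a 1 - b 1) \<le> e" by (rule Suc.prems(3)) simp
  then have e: "e \<ge> 0" using norm_ge_zero[of "a 1 - b 1"] by linarith
  have "norm A \<le> B ^ l"
    unfolding A_def prod_norm[symmetric] using Suc.prems prod_mono[of "{1..l}" "\<lambda>j. norm (a j)" "\<lambda>_. B"]
    by simp
  have "(\<Prod>j=1..Suc l. a j) - (\<Prod>j=1..Suc l. b j) = A * (a (Suc l) - b (Suc l)) + (A - A') * b (Suc l)"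
    by (simp add: A_def A'_def algebra_simps)
  also have "norm \<dots> \<le> norm A * norm (a (Suc l) - b (Suc l)) + norm (A - A') * norm (b (Suc l))"
    by (metis norm_mult norm_triangle_ineq)
  also have "\<dots> \<le> B ^ l * e + (real l * e * B ^ l) * B"
  proof (intro add_mono mult_mono)
    show "norm (A - A') \<le> real l * e * B ^ l" unfolding A_def A'_def using Suc by simp
  qed (use Suc.prems \<open>norm A \<le> B ^ l\<close> B e in auto)
  also have "\<dots> \<le> B ^ l * B * e + (real l * e * B ^ l) * B"
    using B e by (intro add_right_mono mult_right_mono) (auto simp: mult_le_cancel_left1)
  also have "\<dots> = real (Suc l) * e * B ^ Suc l" by (simp add: algebra_simps)
  finally show ?case .
qed simp

subsection \<open>The main theorem\<close>

lemma sum_inverse_le: "N \<ge> 1 \<Longrightarrow> (\<Sum>n=1..N. 1 / real n) \<le> 1 + ln (real N)"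
proof (induction N rule: dec_induct)
  case (step n)
  have "(real (Suc n) - real n) / real (Suc n) \<le> ln (real (Suc n)) - ln (real n)"
    using step by (intro ln_ln_diff_ge) auto
  with step show ?case by simp
qed simp

text \<open>Bernoulli's inequality, scaled by a^l. With a = ln ln T and b = ln ln ln T - O(1) it
  yields the leading terms of the theorem.\<close>

lemma power_add_ge:
  assumes "(a::real) > 0" "a + b \<ge> 0" "l \<ge> 1"
  shows "a ^ l + real l * a ^ (l - 1) * b \<le> (a + b) ^ l"
proof -
  have "1 + real l * (b / a) \<le> (1 + b / a) ^ l"
    using assms by (intro Bernoulli_inequality) (simp add: field_simps)
  then have "a ^ l * (1 + real l * (b / a)) \<le> a ^ l * (1 + b / a) ^ l"
    using assms by (intro mult_left_mono) auto
  also have "\<dots> = (a * (1 + b / a)) ^ l" by (simp add: power_mult_distrib)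
  also have "a * (1 + b / a) = a + b" using assms by (simp add: field_simps)
  also have "a ^ l * (1 + real l * (b / a)) = a ^ l + real l * a ^ (l - 1) * b"
    using assms by (cases l) (auto simp: field_simps)
  finally show ?thesis .
qed

text \<open>A crude choice of the truncation point; it enters the final estimate only through its
  logarithm.\<close>

lemma prod_primes_upto_power_le: "(\<Prod>(primes_upto x)) ^ x \<le> x ^ (x * x)"
proof (cases "x = 0")
  case False
  have "\<Prod>(primes_upto x) \<le> (\<Prod>p\<in>primes_upto x. x)"
    by (rule prod_mono) (auto dest: primes_uptoD)
  also have "\<dots> = x ^ card (primes_upto x)" by simp
  also have "\<dots> \<le> x ^ x"
  proof (rule power_increasing)
    have "card (primes_upto x) \<le> card {1..x}"
      by (rule card_mono) (auto simp: primes_upto_def dest: prime_ge_1_nat)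
    then show "card (primes_upto x) \<le> x" by simp
  qed (use False in simp)
  finally have "(\<Prod>(primes_upto x)) ^ x \<le> (x ^ x) ^ x" by (rule power_mono) simp
  then show ?thesis by (simp add: power_mult)
qed simp

lemma zeta_product_ge:
  fixes T :: real
  assumes l: "l \<ge> 1" and T: "T \<ge> 4" and x: "x \<ge> 2" and N: "real N \<ge> T\<^sup>2" "x ^ (x * x) \<le> N"
    and B: "1 + (\<Sum>n=1..N. 1 / real n) \<le> B" and e: "(1 + 4 * real l) / sqrt T \<le> 1"
    and V: "0 \<le> V" "\<And>t. t \<in> {sqrt T..T} \<Longrightarrow> (\<Prod>j=1..l. cmod (zeta (1 + \<i> * of_real (real j * t)))) \<le> V"
  shows "(\<Prod>j=1..l. \<Prod>p\<in>primes_upto x. \<Sum>k\<le>x. ((1 - real p / real x) ^ j / real p) ^ k)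
    \<le> V + real l * ((1 + 4 * real l) / sqrt T) * B ^ l
      + B ^ l * (\<Prod>p\<in>primes_upto x. real x / real p)\<^sup>2 * (2 / sqrt T)"
proof -
  \<comment> \<open>The share 1 / sqrt T comes from the pole term, 4 l / sqrt T from the tail with N
    >= T^2.\<close>
  define e where "e = (1 + 4 * real l) / sqrt T"
  define m where "m = nat \<lfloor>sqrt T\<rfloor>"
  define H where "H = (\<Sum>n=1..N. 1 / real n)"
  have H0: "0 \<le> H" unfolding H_def by (intro sum_nonneg) auto
  have sq: "sqrt T \<ge> 2" "sqrt T * sqrt T = T" "sqrt T > 0" "sqrt T \<le> T"
  proof -
    have "sqrt 4 \<le> sqrt T" using T by (rule real_sqrt_le_mono)
    then show 2: "sqrt T \<ge> 2" by simp
    then show "sqrt T > 0" by linarith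
    show "sqrt T * sqrt T = T" using T by simp
    then show "sqrt T \<le> T" using 2 mult_left_mono[of 1 "sqrt T" "sqrt T"] by linarith
  qed
  have m: "real m \<le> sqrt T" "real m \<ge> sqrt T / 2" "m \<ge> 1"
    using sq unfolding m_def by linarith+
  have "T\<^sup>2 \<ge> 1" using T by (simp add: power2_eq_square mult_ge1_I)
  then have N1: "N \<ge> 1" using N by linarith
  have zd: "cmod (zeta (1 + \<i> * of_real (real j * t)) - dpoly N j t) \<le> e"
    if t: "t \<in> {sqrt T..T}" and j: "j \<in> {1..l}" for t j
  proof -
    have t0: "t > 0" using t sq by auto
    have "cmod (zeta (1 + \<i> * of_real (real j * t)) - dpoly N j t)
       \<le> 1 / t + 2 * (1 + real j * t) / real N"
      using j t0 N1 by (intro norm_zeta_minus_dpoly_le) auto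
    also have "\<dots> \<le> 1 / sqrt T + 2 * (2 * real l * T) / T\<^sup>2"
    proof (intro add_mono frac_le mult_left_mono)
      have "real j * t \<le> real l * T" using j t t0 by (intro mult_mono) auto
      moreover have "1 \<le> real l * T" using l T by (intro mult_ge1_I[of "real l" T]) auto
      ultimately show "1 + real j * t \<le> 2 * real l * T" by linarith
    qed (use t sq T N l in auto)
    also have "2 * (2 * real l * T) / T\<^sup>2 = 4 * real l / T" using T by (simp add: power2_eq_square)
    also have "\<dots> \<le> 4 * real l / sqrt T" using sq by (intro divide_left_mono) auto
    also have "1 / sqrt T + 4 * real l / sqrt T = e" by (simp add: e_def add_divide_distrib)
    finally show ?thesis by simp
  qed
  \<comment> \<open>The extra 1 lets B bound the zeta values too, since they differ from the
    polynomials by at most e <= 1.\<close>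
  have HB: "H \<le> B" "H + 1 \<le> B" "1 \<le> B" using B H0 unfolding H_def by linarith+
  have bnd: "cmod (\<Prod>j=1..l. dpoly N j t) \<le> V + real l * e * B ^ l" if t: "t \<in> {sqrt T..T}" for t
  proof -
    define Z where "Z j = zeta (1 + \<i> * of_real (real j * t))" for j
    have "cmod ((\<Prod>j=1..l. dpoly N j t) - (\<Prod>j=1..l. Z j)) \<le> real l * e * B ^ l"
    proof (rule norm_prod_diff_le)
      fix j assume j: "j \<in> {1..l}"
      show 1: "cmod (dpoly N j t) \<le> B"
        using norm_dpoly_le[of N j t] HB unfolding H_def by linarith
      show 2: "cmod (dpoly N j t - Z j) \<le> e"
        using zd[OF t j] by (simp add: Z_def norm_minus_commute)
      have "cmod (Z j) \<le> cmod (dpoly N j t) + cmod (dpoly N j t - Z j)"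
        by (metis norm_minus_commute norm_triangle_sub)
      then show "cmod (Z j) \<le> B"
        using 2 assms(7) norm_dpoly_le[of N j t] HB unfolding H_def e_def by linarith
    qed (use HB in auto)
    moreover have "cmod (\<Prod>j=1..l. Z j) \<le> V" using V(2)[OF t] by (simp add: prod_norm Z_def)
    ultimately show ?thesis
      using norm_triangle_sub[of "\<Prod>j=1..l. dpoly N j t" "\<Prod>j=1..l. Z j"] by linarith
  qed
  have V'0: "0 \<le> V + real l * e * B ^ l"
    using V HB sq unfolding e_def by (intro add_nonneg_nonneg mult_nonneg_nonneg) auto
  have res: "(\<Prod>j=1..l. \<Prod>p\<in>primes_upto x. \<Sum>k\<le>x. ((1 - real p / real x) ^ j / real p) ^ k)
    \<le> (V + real l * e * B ^ l) + H ^ l * (\<Prod>p\<in>primes_upto x. 1 / (1 - (1 - real p / real x)))\<^sup>2 / real m"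
    unfolding H_def
  proof (rule resonance[where h = "sqrt T"])
    show "(\<Prod>(primes_upto x)) ^ x \<le> N" using prod_primes_upto_power_le[of x] N by linarith
    show "0 \<le> 1 - real p / real x \<and> 1 - real p / real x < 1" if "p \<in> primes_upto x" for p
      using primes_uptoD[OF that] x by simp
    fix k assume k: "1 \<le> k" "k < m"
    show "cmod (\<Prod>j=1..l. dpoly N j (sqrt T * real k)) \<le> V + real l * e * B ^ l"
    proof (rule bnd)
      have "sqrt T * 1 \<le> sqrt T * real k" using k sq by (intro mult_left_mono) auto
      moreover have "sqrt T * real k \<le> sqrt T * sqrt T" using k sq m by (intro mult_left_mono) auto
      ultimately show "sqrt T * real k \<in> {sqrt T..T}" using sq by simp
    qed
  qed (use m V'0 in \<open>auto dest: primes_uptoD\<close>)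
  have "H ^ l * (\<Prod>p\<in>primes_upto x. 1 / (1 - (1 - real p / real x)))\<^sup>2 / real m
    = H ^ l * (\<Prod>p\<in>primes_upto x. real x / real p)\<^sup>2 * (1 / real m)" by simp
  also have "\<dots> \<le> B ^ l * (\<Prod>p\<in>primes_upto x. real x / real p)\<^sup>2 * (2 / sqrt T)"
  proof (intro mult_mono power_mono)
    have "1 / real m \<le> 1 / (sqrt T / 2)" using m sq by (intro divide_left_mono mult_pos_pos) auto
    then show "1 / real m \<le> 2 / sqrt T" by simp
  qed (use H0 HB in \<open>auto intro!: prod_nonneg\<close>)
  finally show ?thesis using res unfolding e_def by linarith
qed

theorem theorem1:
  fixes l :: nat
  assumes "l \<ge> 1"
  shows "\<exists>C > 0. \<exists>T0. \<forall>T::real. T \<ge> T0 \<longrightarrow>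
    (\<exists>t\<in>{sqrt T..T}.
        (\<Prod>j=1..l. cmod (zeta (1 + \<i> * of_real (real j * t))))
        \<ge> exp (real l * euler_mascheroni) *
           ((ln (ln T)) ^ l + real l * (ln (ln T)) ^ (l - 1) * ln (ln (ln T))
            - C * (ln (ln T)) ^ (l - 1)))"
proof -
  obtain C1 where C1: "C1 > 0"
    "\<And>x. x \<ge> 8 \<Longrightarrow> (\<Prod>p\<in>primes_upto x. real x / real p) \<le> exp (C1 * real x / ln (real x))"
    using prod_ratio_primes_le by metis
  obtain C2 where C2: "C2 > 0" "\<And>j x. j \<le> l \<Longrightarrow> 2 * l + 1 \<le> x \<Longrightarrow> 2 \<le> x \<Longrightarrow>
     exp euler_mascheroni * (ln (real x) - C2)
       \<le> (\<Prod>p\<in>primes_upto x. \<Sum>k\<le>x. ((1 - real p / real x) ^ j / real p) ^ k)"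
    by (rule resonating_product_ge[of l]) (rule that, assumption, simp only:)
  \<comment> \<open>Chosen so that R(0)^2 <= exp (2 C1 c ln T) <= T^(1/8).\<close>
  define c where "c = min 1 (1 / (16 * C1))"
  have c: "c > 0" "c \<le> 1" "2 * C1 * c \<le> 1 / 8"
  proof -
    have "C1 * c \<le> C1 * (1 / (16 * C1))" using C1 by (intro mult_left_mono) (auto simp: c_def)
    then show "2 * C1 * c \<le> 1 / 8" using C1 by simp
  qed (use C1 in \<open>auto simp: c_def\<close>)
  \<comment> \<open>Collects every constant subtracted from ln ln T + ln ln ln T: \<open>C2\<close>
    from the Euler product and ln (c/2) from the size of x.\<close>
  define C3 where "C3 = C2 - ln (c / 2)"
  have C3: "C3 > 0"
  proof -
    have "ln (c / 2) < 0" using c by (subst ln_less_zero_iff) auto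
    then show ?thesis using C2 by (simp add: C3_def)
  qed
  \<comment> \<open>The first summand comes from Bernoulli's inequality. The 2 covers the
    approximation error, at most 1, and leaves a surplus of 1 for the contradiction.\<close>
  define C where "C = real l * C3 + 2"
  \<comment> \<open>The l-th power of T^d is T^(1/8).\<close>
  define d where "d = 1 / (8 * real l)"
  have d: "d > 0" using assms by (simp add: d_def)
  \<comment> \<open>The coefficients of the two error terms, each measured against T^(-1/4).\<close>
  define A where "A = real l * (1 + 4 * real l) + 2"
  have "\<forall>\<^sub>F T in at_top. T \<ge> (4::real) \<and> ln T \<ge> 2 * real l + 8 \<and> ln (ln T) \<ge> 1 \<and> c * ln (ln T) / 2 \<ge> 1
      \<and> ln (ln (ln T)) + ln (c / 2) \<ge> 0 \<and> ln (ln (ln T)) \<ge> 0 \<and> ln (ln T) \<ge> C3 \<and> (1 + 4 * real l) / sqrt T \<le> 1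
      \<and> 3 * ln T ^ 6 \<le> T powr d \<and> A * T powr (- 1 / 4) \<le> 1"
  proof (intro eventually_conj)
    show "\<forall>\<^sub>F T in at_top. T \<ge> (4::real)" by (rule eventually_ge_at_top)
    show "\<forall>\<^sub>F T::real in at_top. ln T \<ge> 2 * real l + 8"
      using filterlim_at_top[THEN iffD1, OF ln_at_top] by blast
    have ln2: "filterlim (\<lambda>T::real. ln (ln T)) at_top at_top" by real_asymp
    have ln3: "filterlim (\<lambda>T::real. ln (ln (ln T))) at_top at_top" by real_asymp
    show "\<forall>\<^sub>F T::real in at_top. ln (ln T) \<ge> 1" "\<forall>\<^sub>F T::real in at_top. ln (ln T) \<ge> C3"
      using filterlim_at_top[THEN iffD1, OF ln2] by blast+
    have "\<forall>\<^sub>F T::real in at_top. ln (ln T) \<ge> 2 / c"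
      using filterlim_at_top[THEN iffD1, OF ln2] by blast
    then show "\<forall>\<^sub>F T::real in at_top. c * ln (ln T) / 2 \<ge> 1"
      by eventually_elim (use c in \<open>simp add: field_simps\<close>)
    have "\<forall>\<^sub>F T::real in at_top. ln (ln (ln T)) \<ge> - ln (c / 2)"
      using filterlim_at_top[THEN iffD1, OF ln3] by blast
    then show "\<forall>\<^sub>F T::real in at_top. ln (ln (ln T)) + ln (c / 2) \<ge> 0" by eventually_elim simp
    show "\<forall>\<^sub>F T::real in at_top. ln (ln (ln T)) \<ge> 0"
      using filterlim_at_top[THEN iffD1, OF ln3] by blast
    have "((\<lambda>T::real. (1 + 4 * real l) / sqrt T) \<longlongrightarrow> 0) at_top" by real_asymp
    from order_tendstoD(2)[OF this, of 1] show "\<forall>\<^sub>F T in at_top. (1 + 4 * real l) / sqrt T \<le> 1"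
      by (rule eventually_mono) auto
    show "\<forall>\<^sub>F T::real in at_top. 3 * ln T ^ 6 \<le> T powr d" using d by real_asymp
    have "((\<lambda>T::real. A * T powr (- 1 / 4)) \<longlongrightarrow> 0) at_top" by real_asymp
    from order_tendstoD(2)[OF this, of 1] show "\<forall>\<^sub>F T in at_top. A * T powr (- 1 / 4) \<le> 1"
      by (rule eventually_mono) auto
  qed
  then obtain T0 where T0: "\<And>T. T \<ge> T0 \<Longrightarrow> T \<ge> (4::real) \<and> ln T \<ge> 2 * real l + 8 \<and> ln (ln T) \<ge> 1 \<and> c * ln (ln T) / 2 \<ge> 1
      \<and> ln (ln (ln T)) + ln (c / 2) \<ge> 0 \<and> ln (ln (ln T)) \<ge> 0 \<and> ln (ln T) \<ge> C3 \<and> (1 + 4 * real l) / sqrt T \<le> 1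
      \<and> 3 * ln T ^ 6 \<le> T powr d \<and> A * T powr (- 1 / 4) \<le> 1"
    unfolding eventually_at_top_linorder by blast
  have main: "\<exists>t\<in>{sqrt T..T}. exp (real l * euler_mascheroni) *
           ((ln (ln T)) ^ l + real l * (ln (ln T)) ^ (l - 1) * ln (ln (ln T)) - C * (ln (ln T)) ^ (l - 1))
      \<le> (\<Prod>j=1..l. cmod (zeta (1 + \<i> * of_real (real j * t))))" if "T \<ge> T0" for T
  proof (rule ccontr)
    assume neg: "\<not> ?thesis"
    define L L2 L3 where "L = ln T" and "L2 = ln L" and "L3 = ln L2"
    have T: "T \<ge> 4" "L \<ge> 2 * real l + 8" "L2 \<ge> 1" "c * L2 / 2 \<ge> 1" "L3 + ln (c / 2) \<ge> 0" "L3 \<ge> 0" "L2 \<ge> C3"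
       "(1 + 4 * real l) / sqrt T \<le> 1" "3 * L ^ 6 \<le> T powr d" "A * T powr (- 1 / 4) \<le> 1"
      using T0[OF that] unfolding L_def L2_def L3_def by auto
    define V where "V = exp (real l * euler_mascheroni) * (L2 ^ l + real l * L2 ^ (l - 1) * L3 - C * L2 ^ (l - 1))"
    have VV: "(\<Prod>j=1..l. cmod (zeta (1 + \<i> * of_real (real j * t)))) \<le> V" if "t \<in> {sqrt T..T}" for t
      using neg that unfolding V_def L_def L2_def L3_def by force
    have "sqrt T \<le> T" using T(1) by (intro real_le_lsqrt) (auto simp: power2_eq_square)
    \<comment> \<open>Under the negated claim V exceeds a nonnegative product at t = T, so its sign
      needs no separate computation.\<close>
    then have V0: "0 \<le> V" using VV[of T] prod_nonneg[of "{1..l}" "\<lambda>j. cmod (zeta (1 + \<i> * of_real (real j * T)))"] by force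
    define x where "x = nat \<lfloor>c * L * L2\<rfloor>"
    have LL: "c * L * L2 \<ge> 2 * L"
      using mult_left_mono[OF T(4), of "2 * L"] T(2) by (simp add: algebra_simps)
    \<comment> \<open>The floor at most halves c L L2, which is the source of ln (c/2)
      below.\<close>
    have x: "real x \<le> c * L * L2" "real x \<ge> c * L * L2 / 2" "real x \<ge> L"
      using LL T(2) unfolding x_def by linarith+
    have x8: "x \<ge> 8" "x \<ge> 2 * l + 1" using x(3) T(2) by linarith+
    have lnx: "ln (real x) \<ge> L2 + L3 + ln (c / 2)"
    proof -
      have "ln (L * L2 * (c / 2)) \<le> ln (real x)"
        using x T c by (subst ln_le_cancel_iff) (auto simp: algebra_simps)
      moreover have "ln (L * L2 * (c / 2)) = L2 + L3 + ln (c / 2)"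
        using T c unfolding L2_def L3_def by (subst ln_mult_pos | force)+
      ultimately show ?thesis by simp
    qed
    then have lnx2: "ln (real x) \<ge> L2" using T by linarith
    have xlnx: "real x / ln (real x) \<le> c * L"
    proof -
      have "real x / ln (real x) \<le> (c * L * L2) / L2"
        using x lnx2 T by (intro frac_le) auto
      then show ?thesis using T by simp
    qed
    have R: "(\<Prod>p\<in>primes_upto x. real x / real p)\<^sup>2 \<le> T powr (1/8)"
    proof -
      have "C1 * real x / ln (real x) \<le> C1 * (c * L)"
        using mult_left_mono[OF xlnx, of C1] C1 by simp
      then have "exp (C1 * real x / ln (real x)) \<le> exp (C1 * (c * L))" by simp
      then have "(\<Prod>p\<in>primes_upto x. real x / real p) \<le> exp (C1 * (c * L))"
        using C1(2)[OF x8(1)] by linarith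
      then have "(\<Prod>p\<in>primes_upto x. real x / real p)\<^sup>2 \<le> (exp (C1 * (c * L)))\<^sup>2"
        by (intro power_mono prod_nonneg) auto
      also have "\<dots> = exp ((2 * C1 * c) * L)" by (simp add: exp_double[symmetric] mult_ac)
      also have "\<dots> \<le> exp (1/8 * L)" using c T by (simp add: mult_right_mono)
      also have "\<dots> = T powr (1/8)" using T by (simp add: powr_def L_def)
      finally show ?thesis .
    qed
    define N where "N = x ^ (x * x)"
    have lnN: "ln (real N) = real x * real x * ln (real x)"
      using x8 by (simp add: N_def ln_realpow)
    have N2: "real N \<ge> T\<^sup>2"
    proof -
      have "2 * L \<le> real x * real x * ln (real x)"
      proof -
        have "2 * L \<le> real x * real x" using x(3) x8(1) T(2) by (intro mult_mono) auto
        also have "\<dots> \<le> real x * real x * ln (real x)"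
          using lnx2 T(3) by (intro mult_le_cancel_left1[THEN iffD2]) (auto simp: mult_le_cancel_left1)
        finally show ?thesis .
      qed
      then have "ln (T\<^sup>2) \<le> ln (real N)" unfolding lnN using T by (simp add: ln_realpow L_def)
      moreover have "real N > 0" using x8 by (simp add: N_def)
      ultimately show ?thesis using T by (subst (asm) ln_le_cancel_iff) auto
    qed
    \<comment> \<open>From x <= L^2 and ln N <= x^3 the harmonic sum is at most 1 + L^6; the
      remaining constants are absorbed in 2 L^6.\<close>
    have B: "1 + (\<Sum>n=1..N. 1 / real n) \<le> 3 * L ^ 6"
    proof -
      have "(\<Sum>n=1..N. 1 / real n) \<le> 1 + ln (real N)"
        using x8 by (intro sum_inverse_le) (simp add: N_def Suc_le_eq)
      also have "ln (real N) \<le> real x * real x * real x"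
        unfolding lnN using x8 ln_le_minus_one[of "real x"] by (intro mult_left_mono) auto
      also have "\<dots> = real x ^ 3" by (simp add: power3_eq_cube)
      also have "\<dots> \<le> (L ^ 2) ^ 3"
      proof (rule power_mono)
        have "L2 \<le> L" unfolding L2_def using ln_le_minus_one[of L] T(2) by simp
        have "real x \<le> (c * L) * L2" using x by simp
        also have "\<dots> \<le> (1 * L) * L" using c T \<open>L2 \<le> L\<close> by (intro mult_mono) auto
        finally show "real x \<le> L ^ 2" by (simp add: power2_eq_square)
      qed simp
      also have "(L ^ 2) ^ 3 = L ^ 6" by (simp flip: power_mult)
      finally have "1 + (\<Sum>n=1..N. 1 / real n) \<le> 2 + L ^ 6" by simp
      moreover have "1 \<le> L ^ 6" using T(2) by (intro one_le_power) auto
      ultimately show ?thesis by linarith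
    qed
    have B8: "(3 * L ^ 6) ^ l \<le> T powr (1/8)"
    proof -
      have "(3 * L ^ 6) ^ l \<le> (T powr d) ^ l" using T by (intro power_mono) auto
      also have "\<dots> = T powr (1/8)" using assms T by (simp add: powr_power d_def)
      finally show ?thesis .
    qed
    have sT: "1 / sqrt T = T powr (-1/2)" using T by (simp add: powr_minus powr_half_sqrt inverse_eq_divide)
    \<comment> \<open>The exponents of T are -1/2 + 1/8 <= -1/4 for the approximation error and 1/8
      + 1/8 - 1/2 = -1/4 for the diagonal.\<close>
    have err: "real l * ((1 + 4 * real l) / sqrt T) * (3 * L ^ 6) ^ l
      + (3 * L ^ 6) ^ l * (\<Prod>p\<in>primes_upto x. real x / real p)\<^sup>2 * (2 / sqrt T) \<le> 1"
    proof -
      have "real l * ((1 + 4 * real l) / sqrt T) * (3 * L ^ 6) ^ l \<le> real l * (1 + 4 * real l) * T powr (-1/4)"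
      proof -
        have "real l * ((1 + 4 * real l) / sqrt T) * (3 * L ^ 6) ^ l
            = real l * (1 + 4 * real l) * (T powr (-1/2) * (3 * L ^ 6) ^ l)"
          unfolding sT[symmetric] by simp
        also have "\<dots> \<le> real l * (1 + 4 * real l) * (T powr (-1/2) * T powr (1/8))"
          using B8 by (intro mult_left_mono) auto
        also have "T powr (-1/2) * T powr (1/8) \<le> T powr (-1/4)"
          unfolding powr_add[symmetric] using T by (intro powr_mono) auto
        finally show ?thesis by (simp add: mult_left_mono)
      qed
      moreover have "(3 * L ^ 6) ^ l * (\<Prod>p\<in>primes_upto x. real x / real p)\<^sup>2 * (2 / sqrt T) \<le> 2 * T powr (-1/4)"
      proof -
        have "(3 * L ^ 6) ^ l * (\<Prod>p\<in>primes_upto x. real x / real p)\<^sup>2 * (2 / sqrt T)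
            \<le> T powr (1/8) * T powr (1/8) * (2 / sqrt T)"
          using B8 R T by (intro mult_right_mono mult_mono) auto
        also have "\<dots> = 2 * (T powr (1/8) * T powr (1/8) * T powr (-1/2))" unfolding sT[symmetric] by simp
        also have "T powr (1/8) * T powr (1/8) * T powr (-1/2) = T powr (-1/4)"
          unfolding powr_add[symmetric] by simp
        finally show ?thesis .
      qed
      ultimately show ?thesis using T(10) by (simp add: A_def algebra_simps)
    qed
    have "(\<Prod>j=1..l. \<Prod>p\<in>primes_upto x. \<Sum>k\<le>x. ((1 - real p / real x) ^ j / real p) ^ k) \<le> V + 1"
      using zeta_product_ge[OF assms T(1) _ N2 _ B T(8) V0 VV, of x] x8 err by (simp add: N_def)
    moreover have "(exp euler_mascheroni * (L2 + (L3 - C3))) ^ l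
        \<le> (\<Prod>j=1..l. \<Prod>p\<in>primes_upto x. \<Sum>k\<le>x. ((1 - real p / real x) ^ j / real p) ^ k)"
    proof -
      have "(exp euler_mascheroni * (L2 + (L3 - C3))) ^ l = (\<Prod>j=1..l. exp euler_mascheroni * (L2 + (L3 - C3)))"
        by simp
      also have "\<dots> \<le> (\<Prod>j=1..l. \<Prod>p\<in>primes_upto x. \<Sum>k\<le>x. ((1 - real p / real x) ^ j / real p) ^ k)"
      proof (intro prod_mono conjI)
        fix j assume j: "j \<in> {1..l}"
        show "0 \<le> exp euler_mascheroni * (L2 + (L3 - C3))" using T by simp
        have "exp euler_mascheroni * (L2 + (L3 - C3)) \<le> exp euler_mascheroni * (ln (real x) - C2)"
          using lnx by (intro mult_left_mono) (auto simp: C3_def)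
        also have "\<dots> \<le> (\<Prod>p\<in>primes_upto x. \<Sum>k\<le>x. ((1 - real p / real x) ^ j / real p) ^ k)"
          using j x8 by (intro C2(2)) auto
        finally show "exp euler_mascheroni * (L2 + (L3 - C3))
          \<le> (\<Prod>p\<in>primes_upto x. \<Sum>k\<le>x. ((1 - real p / real x) ^ j / real p) ^ k)" .
      qed
      finally show ?thesis .
    qed
    \<comment> \<open>Together with the bound V + 1 for the resonating product this gives V + 2 <= V
      + 1.\<close>
    moreover have "V + 2 \<le> (exp euler_mascheroni * (L2 + (L3 - C3))) ^ l"
    proof -
      have E: "1 \<le> exp (real l * euler_mascheroni)" using euler_mascheroni_pos by simp
      have "1 \<le> L2 ^ (l - 1)" using T(3) by (rule one_le_power)
      then have "2 * 1 \<le> exp (real l * euler_mascheroni) * (2 * L2 ^ (l - 1))"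
        using mult_mono[OF E, of 2 "2 * L2 ^ (l - 1)"] by simp
      then have "V + 2 \<le> V + exp (real l * euler_mascheroni) * (2 * L2 ^ (l - 1))" by simp
      also have "\<dots> = exp (real l * euler_mascheroni) * (L2 ^ l + real l * L2 ^ (l - 1) * (L3 - C3))"
        by (simp add: V_def C_def algebra_simps)
      also have "\<dots> \<le> exp (real l * euler_mascheroni) * (L2 + (L3 - C3)) ^ l"
        using T assms by (intro mult_left_mono power_add_ge) auto
      also have "\<dots> = (exp euler_mascheroni * (L2 + (L3 - C3))) ^ l"
        by (simp add: power_mult_distrib exp_of_nat_mult)
      finally show ?thesis .
    qed
    ultimately show False by linarith
  qed
  have "C > 0" using C3 by (simp add: C_def add_nonneg_pos)
  then show ?thesis using main by blast
qed

end
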